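(* Let $K$ be a totally real number field of degree $n \geq 2$ with ring of integers $\mathcal{O}_K$ and real embeddings $\sigma_1,\dots,\sigma_n : K \to \mathbb{R}$. Let $V \subset \mathcal{S}(\mathbb{R}^n)$ denote the complex linear span of all Gaussians $x=(x_1,\dots,x_n) \mapsto e^{\pi i z_1 x_1^2}\cdots e^{\pi i z_n x_n^2}$ with $z_1,\dots,z_n \in \mathbb{H}$. Then for any $\epsilon \in \{\pm 1\}$ the subspace of all $f \in V$ satisfying $\widehat{f} = \epsilon f$ and $f(x) = 0$ for all $x \in \sqrt{\mathcal{O}_K^{\vee}}$ is infinite dimensional.
   Context: $\mathbb{H} = \{z \in \mathbb{C} : \operatorname{Im}(z)>0\}$. $\mathcal{S}(\mathbb{R}^n)$ is the space of complex-valued Schwartz functions. The Fourier transform is $\widehat{f}(\xi) = \int_{\mathbb{R}^n} f(x) e^{-2\pi i \langle x,\xi\rangle}dx$. The codifferent is $\mathcal{O}_K^{\vee} = \{x \in K : \operatorname{Tr}_{K/\mathbb{Q}}(ax) \in \mathbb{Z} \text{ for all } a \in \mathcal{O}_K\}$. For a fractional ideal $\mathfrak{a} \subset K$, $\sqrt{\mathfrak{a}} := \{(x_1,\dots,x_n) \in \mathbb{R}^n : (x_1^2,\dots,x_n^2) = (\sigma_1(\alpha),\dots,\sigma_n(\alpha)) \text{ for some } \alpha \in \mathfrak{a}\}$. *)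

theory Defs
  imports
    "HOL-Analysis.Analysis"
    "HOL-Computational_Algebra.Polynomial"
    "HOL-Library.Function_Algebras"
begin

section \<open>Number fields as types\<close>

text \<open>A number field is a type of class \<^class>\<open>field_char_0\<close> that is finite-dimensional over the
  rationals, the scalar action being multiplication by \<^const>\<open>of_rat\<close>.\<close>

global_interpretation rat_vs: vector_space "\<lambda>(q::rat) (x::'k::field_char_0). of_rat q * x"
  by unfold_locales (simp_all add: algebra_simps of_rat_add of_rat_mult)

definition rat_basis :: "'k::field_char_0 set \<Rightarrow> bool" where
  "rat_basis B \<longleftrightarrow> finite B \<and> rat_vs.independent B \<and> rat_vs.span B = UNIV"

definition number_field :: "'k::field_char_0 itself \<Rightarrow> bool" where
  "number_field _ \<longleftrightarrow> (\<exists>B :: 'k set. rat_basis B)"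

definition field_degree :: "'k::field_char_0 itself \<Rightarrow> nat" where
  "field_degree _ = rat_vs.dim (UNIV :: 'k set)"

definition field_embedding :: "('k::field \<Rightarrow> 'l::field) \<Rightarrow> bool" where
  "field_embedding \<tau> \<longleftrightarrow> \<tau> 1 = 1 \<and> (\<forall>x y. \<tau> (x + y) = \<tau> x + \<tau> y) \<and> (\<forall>x y. \<tau> (x * y) = \<tau> x * \<tau> y)"

definition totally_real :: "'k::field_char_0 itself \<Rightarrow> bool" where
  "totally_real _ \<longleftrightarrow> (\<forall>\<tau> :: 'k \<Rightarrow> complex. field_embedding \<tau> \<longrightarrow> range \<tau> \<subseteq> \<real>)"

text \<open>The trace of the rational-linear endomorphism \<open>y \<mapsto> x * y\<close>, read off from its matrix with
  respect to some basis; it does not depend on the basis chosen.\<close>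

definition field_trace :: "'k::field_char_0 \<Rightarrow> rat" where
  "field_trace x =
    (let B = (SOME B :: 'k set. rat_basis B) in \<Sum>b\<in>B. rat_vs.representation B (x * b) b)"

definition ring_of_integers :: "'k::field_char_0 set" where
  "ring_of_integers = {x. algebraic_int x}"

definition codifferent :: "'k::field_char_0 set" where
  "codifferent = {x. \<forall>a\<in>ring_of_integers. field_trace (a * x) \<in> \<int>}"

definition sqrt_set :: "('n::finite \<Rightarrow> 'k \<Rightarrow> real) \<Rightarrow> 'k set \<Rightarrow> (real ^ 'n) set" where
  "sqrt_set \<sigma> A = {x. \<exists>\<alpha>\<in>A. \<forall>i. (x $ i)\<^sup>2 = \<sigma> i \<alpha>}"

section \<open>Gaussians and the Fourier transform\<close>

global_interpretation cfun: vector_space "\<lambda>(c::complex) (f::'a \<Rightarrow> complex) x. c * f x"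
  by unfold_locales (simp_all add: fun_eq_iff algebra_simps)

definition infinite_dimensional_subspace :: "('a \<Rightarrow> complex) set \<Rightarrow> bool" where
  "infinite_dimensional_subspace W \<longleftrightarrow>
    cfun.subspace W \<and> \<not> (\<exists>B. finite B \<and> B \<subseteq> W \<and> cfun.span B = W)"

definition fourier_transform :: "(real ^ 'n \<Rightarrow> complex) \<Rightarrow> real ^ 'n \<Rightarrow> complex" where
  "fourier_transform f \<xi> =
    (LINT x|lborel. f x * exp (- 2 * complex_of_real pi * \<i> * complex_of_real (x \<bullet> \<xi>)))"

definition gaussian :: "complex ^ 'n \<Rightarrow> real ^ 'n \<Rightarrow> complex" where
  "gaussian z x = (\<Prod>i\<in>UNIV. exp (complex_of_real pi * \<i> * z $ i * (complex_of_real (x $ i))\<^sup>2))"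

definition gaussian_span :: "(real ^ 'n \<Rightarrow> complex) set" where
  "gaussian_span = cfun.span {gaussian z | z. \<forall>i. Im (z $ i) > 0}"

end

(* Write T_a for the substitution z \<mapsto> z + 2a and F for the Fourier transform, both acting on the
   Gaussians g_z.  On the square root of the codifferent, T_a fixes every Gaussian when a is an algebraic
   integer, since a translation multiplies the value by exp (2 \<pi> i Tr (a \<alpha>)) = 1.  So it suffices to
   produce K in the span of the Gaussians such that both K and F K are sums of differences T_a g - g:
   then K + \<epsilon> F K is an eigenfunction that vanishes on the given set.

   Such a K comes from a relation between F and the T_a.  F acts by z \<mapsto> -1/z up to a scalar factor, so
   F T_a F acts as a lower triangular unipotent matrix, and F T_a F g - g = F (T_a (F g) - F g).  Hence for
   every closed word in the operators T_a and F T_a F, summing the elements T_a (F g) - F g over the lower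
   triangular steps of the word gives a suitable K.  As n \<ge> 2 there is a unit u \<equiv> 1 mod 4 with
   u^2 \<noteq> 1, and then diag (u, 1/u) is a product of four elementary matrices with even entries.
   Conjugating a lower triangular unipotent with entry X by it gives the one with entry X / u^2; this is the
   relation used, without the outer lower triangular factor of diag (u, 1/u), which commutes with both sides.
   Letting X run through the even integers, the parameters of the Gaussians in K + \<epsilon> F K
   escape every finite set, and distinct Gaussians are linearly independent. *)

theory Submission
  imports Defs "HOL-Complex_Analysis.Conformal_Mappings" "HOL-Probability.Characteristic_Functions"
begin

unbundle no Formal_Power_Series.fps_syntax

section \<open>Orders and units of totally real fields\<close>

text \<open>Artin's proof of the independence of characters, for an arbitrary binary operation
  \<open>f\<close>. It serves twice: for embeddings under field multiplication, and for Gaussians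
  under the componentwise operation sqrt (x^2 + y^2).\<close>

lemma multiplicative_functions_independent:
  fixes h :: "'i \<Rightarrow> 'a \<Rightarrow> 'b::field"
  assumes "finite I"
    and mult: "\<And>i x y. i \<in> I \<Longrightarrow> h i (f x y) = h i x * h i y"
    and nz: "\<And>i. i \<in> I \<Longrightarrow> \<exists>x. h i x \<noteq> 0"
    and "inj_on h I"
    and "\<And>x. (\<Sum>i\<in>I. c i * h i x) = 0"
    and "i \<in> I"
  shows "c i = 0"
  using assms
proof (induction I arbitrary: c i rule: finite_induct)
  case empty
  then show ?case by simp
next
  case (insert j I)
  have sum0: "c j * h j x + (\<Sum>i\<in>I. c i * h i x) = 0" for x
    using insert.prems(4)[of x] insert.hyps by simp
  \<comment> \<open>The relation at \<open>f x y\<close> minus \<open>h j y\<close> times the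
    relation at \<open>x\<close> no longer contains the index \<open>j\<close>.\<close>
  have "c k * (h k y - h j y) = 0" if "k \<in> I" for k y
  proof (rule insert.IH[OF _ _ _ _ that])
    show "inj_on h I" using insert.prems(3) by (rule inj_on_subset) auto
    show "(\<Sum>i\<in>I. c i * (h i y - h j y) * h i x) = 0" for x
    proof -
      have "(\<Sum>i\<in>I. c i * (h i y - h j y) * h i x)
          = (\<Sum>i\<in>I. c i * h i (f x y)) - (\<Sum>i\<in>I. c i * h i x) * h j y"
        unfolding sum_distrib_right sum_subtractf[symmetric]
        by (rule sum.cong) (use insert.prems(1) in \<open>auto simp: algebra_simps\<close>)
      also have "\<dots> = - (c j * h j (f x y)) + c j * h j x * h j y"
        using sum0[of "f x y", THEN minus_unique] sum0[of x, THEN minus_unique]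
        by (metis diff_conv_add_uminus minus_minus mult_minus_left)
      also have "\<dots> = 0" using insert.prems(1) by simp
      finally show ?thesis .
    qed
  qed (use insert.prems in auto)
  moreover have "\<exists>y. h k y \<noteq> h j y" if "k \<in> I" for k
    using insert.prems(3) insert.hyps that by (auto simp: inj_on_def fun_eq_iff)
  ultimately have c0: "c k = 0" if "k \<in> I" for k
    using that by (metis mult_eq_0_iff right_minus_eq)
  moreover have "c j = 0"
    using sum0 c0 insert.prems(2)[of j] by auto
  ultimately show ?case using insert.prems(5) by auto
qed

section \<open>Matrices of multiplication, norm and trace\<close>

lemma det_Ints:
  fixes A :: "'a::comm_ring_1 ^ 'n ^ 'n"
  assumes "\<And>i j. A $ i $ j \<in> \<int>"
  shows "det A \<in> \<int>"
  unfolding det_def using assms by (intro Ints_sum Ints_mult Ints_prod) auto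

text \<open>Indexing the rational basis by the same type as the embeddings makes the matrices below
  square and encodes that there are as many real embeddings as the degree.\<close>

locale real_embeddings =
  fixes \<sigma> :: "'n::finite \<Rightarrow> 'k::field_char_0 \<Rightarrow> real" and b :: "'n \<Rightarrow> 'k"
  assumes emb: "field_embedding (\<sigma> i)" and inj_\<sigma>: "inj \<sigma>"
    and inj_b: "inj b" and basis: "rat_basis (range b)"
begin

lemma emb_1 [simp]: "\<sigma> i 1 = 1"
  and emb_add: "\<sigma> i (x + y) = \<sigma> i x + \<sigma> i y"
  and emb_mult: "\<sigma> i (x * y) = \<sigma> i x * \<sigma> i y"
  using emb[of i] by (auto simp: field_embedding_def)

lemma emb_0 [simp]: "\<sigma> i 0 = 0"
  using emb_add[of i 0 0] by simp

lemma emb_minus: "\<sigma> i (- x) = - \<sigma> i x"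
  using emb_add[of i x "- x"] by simp

lemma emb_diff: "\<sigma> i (x - y) = \<sigma> i x - \<sigma> i y"
  using emb_add[of i x "- y"] by (simp add: emb_minus)

lemma emb_sum: "\<sigma> i (\<Sum>a\<in>A. f a) = (\<Sum>a\<in>A. \<sigma> i (f a))"
  by (induction A rule: infinite_finite_induct) (auto simp: emb_add)

lemma emb_of_nat: "\<sigma> i (of_nat m) = of_nat m"
  by (induction m) (auto simp: emb_add)

lemma emb_of_int: "\<sigma> i (of_int m) = of_int m"
  by (cases m rule: int_diff_cases) (simp add: emb_diff emb_of_nat)

lemma emb_numeral: "\<sigma> i (numeral w) = numeral w"
  using emb_of_int[of i "numeral w"] by simp

lemma emb_eq_0_iff [simp]: "\<sigma> i x = 0 \<longleftrightarrow> x = 0"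
proof
  assume "\<sigma> i x = 0"
  then have "\<sigma> i (x * inverse x) = 0" by (simp only: emb_mult)
  then show "x = 0" by (cases "x = 0") auto
qed auto

lemma emb_eq_iff: "\<sigma> i x = \<sigma> i y \<longleftrightarrow> x = y"
  using emb_eq_0_iff[of i "x - y"] by (simp add: emb_diff)

lemma emb_inverse: "\<sigma> i (inverse x) = inverse (\<sigma> i x)"
proof (cases "x = 0")
  case False
  then have "\<sigma> i x * \<sigma> i (inverse x) = 1" by (simp flip: emb_mult)
  then show ?thesis using False by (simp add: field_simps)
qed auto

lemma emb_divide: "\<sigma> i (x / y) = \<sigma> i x / \<sigma> i y"
  by (simp add: divide_inverse emb_mult emb_inverse)

lemma emb_of_rat: "\<sigma> i (of_rat q) = of_rat q"
  by (cases q) (simp add: of_rat_rat emb_divide emb_of_int)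

definition coord :: "'k \<Rightarrow> 'n \<Rightarrow> rat" where
  "coord x i = rat_vs.representation (range b) x (b i)"

lemma indep: "rat_vs.independent (range b)" and span_b: "rat_vs.span (range b) = UNIV"
  using basis by (auto simp: rat_basis_def)

lemma coord_expand: "(\<Sum>i\<in>UNIV. of_rat (coord x i) * b i) = x"
proof -
  have "x = (\<Sum>v\<in>range b. of_rat (rat_vs.representation (range b) x v) * v)"
    using rat_vs.sum_representation_eq[OF indep, of x "range b"] by (simp add: span_b)
  also have "\<dots> = (\<Sum>i\<in>UNIV. of_rat (coord x i) * b i)"
    by (subst sum.reindex) (auto simp: inj_b coord_def)
  finally show ?thesis ..
qed

lemma coord_add: "coord (x + y) i = coord x i + coord y i"
  unfolding coord_def by (subst rat_vs.representation_add[OF indep]) (auto simp: span_b)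

lemma coord_scale: "coord (of_rat q * x) i = q * coord x i"
  unfolding coord_def by (subst rat_vs.representation_scale[OF indep]) (auto simp: span_b)

lemma coord_diff: "coord (x - y) i = coord x i - coord y i"
  unfolding coord_def by (subst rat_vs.representation_diff[OF indep]) (auto simp: span_b)

lemma coord_sum: "coord (\<Sum>a\<in>A. f a) i = (\<Sum>a\<in>A. coord (f a) i)"
proof (induction A rule: infinite_finite_induct)
  have "coord 0 i = 0" using coord_scale[of 0 0 i] by simp
  then show "\<And>A. infinite A \<Longrightarrow> coord (sum f A) i = (\<Sum>a\<in>A. coord (f a) i)"
    "coord (sum f {}) i = (\<Sum>a\<in>{}. coord (f a) i)" by auto
qed (auto simp: coord_add)

lemma coord_basis: "coord (b j) i = (if i = j then 1 else 0)"
  unfolding coord_def using rat_vs.representation_basis[OF indep, of "b j"] inj_b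
  by (auto simp: inj_def)

lemma coord_mult: "coord (x * y) i = (\<Sum>l\<in>UNIV. coord (x * b l) i * coord y l)"
proof -
  have "x * y = (\<Sum>l\<in>UNIV. of_rat (coord y l) * (x * b l))"
    by (subst coord_expand[of y, symmetric]) (simp add: sum_distrib_left mult.left_commute)
  then show ?thesis by (simp only: coord_sum coord_scale mult.commute[of "coord y _"])
qed

definition mulmat :: "'k \<Rightarrow> real ^ 'n ^ 'n" where
  "mulmat x = (\<chi> i j. of_rat (coord (x * b j) i))"

definition embmat :: "real ^ 'n ^ 'n" where
  "embmat = (\<chi> l i. \<sigma> l (b i))"

definition diagmat :: "'k \<Rightarrow> real ^ 'n ^ 'n" where
  "diagmat x = (\<chi> i j. if i = j then \<sigma> i x else 0)"

text \<open>Applying \<open>\<sigma> l\<close> to the expansion of \<open>x * b j\<close> shows that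
  the rows of \<open>embmat\<close> are left eigenvectors of every \<open>mulmat x\<close>, with the
  conjugates of \<open>x\<close> as eigenvalues. Norm and trace are then read off the diagonal
  form.\<close>

lemma embmat_mulmat: "embmat ** mulmat x = diagmat x ** embmat"
proof -
  have "(\<Sum>i\<in>UNIV. \<sigma> l (b i) * of_rat (coord (x * b j) i)) = \<sigma> l x * \<sigma> l (b j)" for l j
    using arg_cong[OF coord_expand[of "x * b j"], of "\<sigma> l"]
    by (simp add: emb_sum emb_mult emb_of_rat mult.commute)
  then show ?thesis
    by (simp add: vec_eq_iff matrix_matrix_mult_def embmat_def mulmat_def diagmat_def
        if_distrib[of "\<lambda>c. c * _"] cong: if_cong)
qed

text \<open>Dedekind's independence of characters, applied to the embeddings.\<close>

lemma invertible_embmat: "invertible embmat"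
proof -
  have "c i = 0" if "(\<Sum>i\<in>UNIV. c i *s row i embmat) = 0" for c i
  proof (rule multiplicative_functions_independent[of UNIV \<sigma> "(*)" c])
    fix x
    have b0: "(\<Sum>l\<in>UNIV. c l * \<sigma> l (b j)) = 0" for j
      using arg_cong[OF that, of "\<lambda>v. v $ j"] by (simp add: row_def embmat_def)
    have "(\<Sum>l\<in>UNIV. c l * \<sigma> l x)
        = (\<Sum>l\<in>UNIV. \<Sum>j\<in>UNIV. of_rat (coord x j) * (c l * \<sigma> l (b j)))"
      by (subst coord_expand[of x, symmetric])
        (simp add: emb_sum emb_mult emb_of_rat sum_distrib_left mult_ac)
    also have "\<dots> = (\<Sum>j\<in>UNIV. of_rat (coord x j) * (\<Sum>l\<in>UNIV. c l * \<sigma> l (b j)))"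
      by (subst sum.swap) (simp add: sum_distrib_left)
    finally show "(\<Sum>l\<in>UNIV. c l * \<sigma> l x) = 0" by (simp add: b0)
  next
    show "\<exists>x. \<sigma> i x \<noteq> 0" for i by (rule exI[of _ 1]) simp
  qed (auto simp: emb_mult inj_\<sigma>)
  then show ?thesis
    by (auto simp: invertible_right_inverse matrix_right_invertible_independent_rows)
qed

lemma det_mulmat: "det (mulmat x) = (\<Prod>i\<in>UNIV. \<sigma> i x)"
proof -
  have "det embmat * det (mulmat x) = det (diagmat x) * det embmat"
    using embmat_mulmat[of x] by (metis det_mul)
  moreover have "det embmat \<noteq> 0" using invertible_embmat by (simp add: invertible_det_nz)
  ultimately have "det (mulmat x) = det (diagmat x)" by simp
  also have "\<dots> = (\<Prod>i\<in>UNIV. \<sigma> i x)"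
    by (subst det_diagonal) (auto simp: diagmat_def)
  finally show ?thesis .
qed

lemma sum_coord_diag: "of_rat (\<Sum>i\<in>UNIV. coord (x * b i) i) = (\<Sum>i\<in>UNIV. \<sigma> i x)"
proof -
  obtain P where P: "P ** embmat = mat 1" "embmat ** P = mat 1"
    using invertible_embmat by (auto simp: invertible_def)
  have "mulmat x = P ** (diagmat x ** embmat)"
    by (metis P(1) embmat_mulmat matrix_mul_assoc matrix_mul_lid)
  then have "trace (mulmat x) = trace (diagmat x)"
    by (metis P(2) matrix_mul_assoc matrix_mul_rid trace_mul_sym)
  then show ?thesis by (simp add: trace_def mulmat_def diagmat_def of_rat_sum)
qed

text \<open>The multiplier ring of the lattice spanned by \<open>b\<close>, an order of the field.
  It stands in for the full ring of integers because membership is a condition on finitely many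
  coordinates.\<close>

definition order_ring :: "'k set" where
  "order_ring = {x. \<forall>i j. coord (x * b j) i \<in> \<int>}"

lemma order_ring_add: "x \<in> order_ring \<Longrightarrow> y \<in> order_ring \<Longrightarrow> x + y \<in> order_ring"
  by (simp add: order_ring_def distrib_right coord_add)

lemma order_ring_diff: "x \<in> order_ring \<Longrightarrow> y \<in> order_ring \<Longrightarrow> x - y \<in> order_ring"
  by (simp add: order_ring_def left_diff_distrib coord_diff)

lemma order_ring_mult: "x \<in> order_ring \<Longrightarrow> y \<in> order_ring \<Longrightarrow> x * y \<in> order_ring"
  unfolding order_ring_def mem_Collect_eq mult.assoc
  by (subst coord_mult) (auto intro: Ints_sum)

lemma order_ring_of_int: "of_int m \<in> order_ring"
proof -
  have "coord (of_int m * b j) i = of_int m * coord (b j) i" for i j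
    using coord_scale[of "of_int m" "b j" i] by simp
  then show ?thesis by (simp add: order_ring_def coord_basis)
qed

lemma order_ring_uminus: "x \<in> order_ring \<Longrightarrow> - x \<in> order_ring"
  using order_ring_diff[OF order_ring_of_int[of 0]] by simp

lemma order_ring_numeral: "numeral m \<in> order_ring"
  using order_ring_of_int[of "numeral m"] by simp

lemma order_ring_1: "1 \<in> order_ring"
  using order_ring_of_int[of 1] by simp

lemma order_ring_sum: "(\<And>a. a \<in> A \<Longrightarrow> f a \<in> order_ring) \<Longrightarrow> (\<Sum>a\<in>A. f a) \<in> order_ring"
  by (induction A rule: infinite_finite_induct)
    (use order_ring_of_int[of 0] in \<open>auto intro: order_ring_add\<close>)

lemma norm_in_Ints:
  assumes "x \<in> order_ring"
  shows "(\<Prod>i\<in>UNIV. \<sigma> i x) \<in> \<int>"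
proof -
  have "det (mulmat x) \<in> \<int>"
  proof (rule det_Ints)
    fix i j
    have "coord (x * b j) i \<in> \<int>" using assms by (simp add: order_ring_def)
    then show "mulmat x $ i $ j \<in> \<int>" by (auto simp: mulmat_def elim: Ints_cases)
  qed
  then show ?thesis by (simp add: det_mulmat)
qed

end

section \<open>Integrality of the elements of the order\<close>

lemma prod_degree_lt:
  fixes f :: "'i \<Rightarrow> 'a::comm_ring_1 poly"
  assumes "finite I" "\<And>i. i \<in> I \<Longrightarrow> degree (f i) \<le> 1" "j \<in> I" "degree (f j) = 0"
  shows "degree (prod f I) < card I"
proof -
  have "degree (prod f I) \<le> sum (degree \<circ> f) I"
    using degree_prod_sum_le[OF assms(1), of f] by (simp add: comp_def)
  also have "\<dots> = (\<Sum>i\<in>I - {j}. degree (f i))"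
    using assms by (simp add: sum.remove[of I j])
  also have "\<dots> \<le> (\<Sum>i\<in>I - {j}. 1)"
    using assms(2) by (intro sum_mono) auto
  also have "\<dots> < card I"
    using assms card_gt_0_iff[of I] by (auto simp: card_Diff_singleton)
  finally show ?thesis .
qed

text \<open>In the Leibniz formula only the identity permutation reaches degree n: any other
  permutation moves some index and picks up a constant entry there.\<close>

lemma det_charmat_monic:
  fixes A :: "'a::field_char_0 ^ 'n ^ 'n"
  shows "degree (det (\<chi> i j. if i = j then [:- (A $ i $ j), 1:] else [:- (A $ i $ j):])) = CARD('n)"
    (is "degree (det ?P) = _")
    and "lead_coeff (det (\<chi> i j. if i = j then [:- (A $ i $ j), 1:] else [:- (A $ i $ j):])) = 1"
proof -
  let ?S = "{p. p permutes (UNIV :: 'n set)}"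
  define t where "t p = of_int (sign p) * (\<Prod>i\<in>UNIV. ?P $ i $ p i)" for p :: "'n \<Rightarrow> 'n"
  have "id \<in> ?S" by (simp add: permutes_id)
  then have split: "det ?P = t id + (\<Sum>p\<in>?S - {id}. t p)"
    unfolding det_def t_def by (subst sum.remove[of _ id]) (auto simp: finite_permutations simp del: permutes_id)
  have id: "t id = (\<Prod>i\<in>UNIV. [:- (A $ i $ i), 1:])" by (simp add: t_def)
  have deg_id: "degree (t id) = CARD('n)" and lead_id: "lead_coeff (t id) = 1"
    unfolding id by (subst degree_prod_eq_sum_degree; simp) (simp add: lead_coeff_prod)
  have small: "degree (t p) < CARD('n)" if p: "p \<in> ?S - {id}" for p
  proof -
    obtain j where j: "p j \<noteq> j" using p by (auto simp: fun_eq_iff)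
    have "degree (\<Prod>i\<in>UNIV. ?P $ i $ p i) < CARD('n)"
      using j by (intro prod_degree_lt[of _ _ j]) auto
    moreover have "degree (of_int (sign p) * q) \<le> degree q" for q :: "'a poly"
      by (metis add_0 degree_mult_le degree_of_int)
    ultimately show ?thesis unfolding t_def by (meson le_less_trans)
  qed
  have rest: "degree (\<Sum>p\<in>?S - {id}. t p) < CARD('n)"
    using small by (intro degree_sum_less) auto
  show "degree (det ?P) = CARD('n)"
    unfolding split using rest deg_id by (simp add: degree_add_eq_left)
  then show "lead_coeff (det ?P) = 1"
    using rest deg_id lead_id by (simp add: split coeff_eq_0)
qed

lemma coeff_mult_Ints:
  "(\<And>i. coeff p i \<in> \<int>) \<Longrightarrow> (\<And>i. coeff q i \<in> \<int>) \<Longrightarrow> coeff (p * q) i \<in> \<int>"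
  by (auto simp: coeff_mult intro!: Ints_sum)

lemma coeff_prod_Ints:
  "(\<And>a i. a \<in> A \<Longrightarrow> coeff (f a) i \<in> \<int>) \<Longrightarrow> coeff (prod f A) i \<in> \<int>"
proof (induction A arbitrary: i rule: infinite_finite_induct)
  case (insert a A)
  then show ?case by (auto intro!: coeff_mult_Ints)
qed (auto simp: one_pCons coeff_pCons split: nat.splits)

lemma poly_det: "poly (det P) x = det (\<chi> i j. poly (P $ i $ j) x)"
  for P :: "'a::comm_ring_1 poly ^ 'n ^ 'n"
  by (simp add: det_def poly_sum poly_prod)

context real_embeddings
begin

text \<open>The characteristic polynomial of multiplication by \<open>x\<close> is an integral equation for \<open>x\<close>.\<close>

lemma algebraic_int_order_ring:
  assumes "x \<in> order_ring"
  shows "algebraic_int x"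
proof -
  define A :: "'k ^ 'n ^ 'n" where "A = (\<chi> i j. of_rat (coord (x * b j) i))"
  define P where "P = (\<chi> i j. if i = j then [:- (A $ i $ j), 1:] else [:- (A $ i $ j):])"
  have A_Ints: "A $ i $ j \<in> \<int>" for i j
  proof -
    have "coord (x * b j) i \<in> \<int>" using assms by (simp add: order_ring_def)
    then show ?thesis by (auto simp: A_def elim: Ints_cases)
  qed
  have P_Ints: "coeff (P $ i $ j) l \<in> \<int>" for i j l
    using A_Ints[of i j] by (auto simp: P_def coeff_pCons split: nat.splits)
  have "coeff (det P) l \<in> \<int>" for l
    unfolding det_def coeff_sum
    by (intro Ints_sum coeff_mult_Ints coeff_prod_Ints P_Ints)
      (auto simp: of_int_poly coeff_pCons split: nat.splits)
  moreover have "poly (det P) x = 0"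
  proof -
    \<comment> \<open>\<open>Q\<close> is x I - A. The equations x b_j = sum_i A_ij b_i say that the
      vector \<open>v\<close> of basis elements lies in the kernel of its transpose.\<close>
    define Q :: "'k ^ 'n ^ 'n" where "Q = (\<chi> i j. poly (P $ i $ j) x)"
    define v :: "'k ^ 'n" where "v = (\<chi> i. b i)"
    have "(\<Sum>i\<in>UNIV. b i * Q $ i $ j) = 0" for j
    proof -
      have "b i * Q $ i $ j = (if i = j then x * b i else 0) - of_rat (coord (x * b j) i) * b i" for i
        by (simp add: Q_def P_def A_def algebra_simps)
      then show ?thesis by (simp add: sum_subtractf coord_expand)
    qed
    then have "transpose Q *v v = 0"
      by (simp add: vec_eq_iff matrix_vector_mult_def transpose_def v_def mult.commute)
    moreover have "v \<noteq> 0"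
    proof
      assume "v = 0"
      then have "b i = 0" for i by (metis v_def vec_lambda_beta zero_index)
      then show False using coord_basis[of undefined undefined] coord_scale[of 0 0 undefined] by simp
    qed
    ultimately have "\<not> invertible (transpose Q)"
      by (auto simp: invertible_left_inverse matrix_left_invertible_ker)
    then have "det Q = 0" by (simp add: invertible_det_nz)
    then show ?thesis by (simp add: poly_det Q_def)
  qed
  moreover have "lead_coeff (det P) = 1"
    unfolding P_def by (rule det_charmat_monic)
  ultimately show ?thesis by (intro algebraic_int.intros) auto
qed

text \<open>By Cramer's rule, \<open>N(x) / x\<close> acts through the adjugate matrix of \<open>x\<close>.\<close>

lemma norm_divide_in_order_ring:
  assumes "x \<in> order_ring" "x \<noteq> 0" "of_int m = (\<Prod>i\<in>UNIV. \<sigma> i x)"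
  shows "of_int m / x \<in> order_ring"
proof -
  let ?M = "mulmat x"
  have M_Ints: "?M $ i $ j \<in> \<int>" for i j
  proof -
    have "coord (x * b j) i \<in> \<int>" using assms(1) by (simp add: order_ring_def)
    then show ?thesis by (auto simp: mulmat_def elim: Ints_cases)
  qed
  have det: "det ?M = of_int m" using assms(3) by (simp add: det_mulmat)
  have "m \<noteq> 0"
    using assms(2,3) by (metis emb_eq_0_iff finite_class.finite_UNIV of_int_0 prod_zero_iff)
  have "coord (of_int m / x * b j) i \<in> \<int>" for i j
  proof -
    \<comment> \<open>\<open>w\<close> is the \<open>j\<close>-th column of the matrix of
      multiplication by 1/x, so it solves \<open>?M *v w = a\<close> with \<open>a\<close> the
      \<open>j\<close>-th unit vector.\<close>
    define w :: "real ^ 'n" where "w = (\<chi> i. of_rat (coord (inverse x * b j) i))"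
    define a :: "real ^ 'n" where "a = (\<chi> i. if i = j then 1 else 0)"
    have "(\<Sum>l\<in>UNIV. coord (x * b l) i * coord (inverse x * b j) l) = (if i = j then 1 else 0)" for i
      using coord_mult[of x "inverse x * b j" i] assms(2)
      by (simp add: coord_basis flip: mult.assoc)
    then have "(\<Sum>l\<in>UNIV. real_of_rat (coord (x * b l) i) * of_rat (coord (inverse x * b j) l))
        = (if i = j then 1 else 0)" for i
      by (metis (mono_tags, lifting) of_rat_0 of_rat_1 of_rat_mult of_rat_sum sum.cong)
    then have "?M *v w = a"
      by (simp add: vec_eq_iff matrix_vector_mult_def mulmat_def w_def a_def)
    then have "w = (\<chi> i. det (\<chi> r c. if c = i then a $ r else ?M $ r $ c) / det ?M)"
      using cramer[of ?M w a] det \<open>m \<noteq> 0\<close> by simp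
    then have "w $ i = det (\<chi> r c. if c = i then a $ r else ?M $ r $ c) / of_int m"
      by (simp add: det)
    moreover have "det (\<chi> r c. if c = i then a $ r else ?M $ r $ c) \<in> \<int>"
      by (rule det_Ints) (use M_Ints in \<open>auto simp: a_def\<close>)
    ultimately obtain q where "real_of_rat (coord (inverse x * b j) i) = of_int q / of_int m"
      by (auto simp: w_def elim: Ints_cases)
    then have "real_of_rat (of_int m * coord (inverse x * b j) i) = real_of_rat (of_int q)"
      using \<open>m \<noteq> 0\<close> by (simp add: of_rat_mult)
    then have "of_int m * coord (inverse x * b j) i = of_int q"
      by (simp only: of_rat_eq_iff)
    then show ?thesis
      using coord_scale[of "of_int m" "inverse x * b j" i] by (simp add: divide_inverse mult.assoc)
  qed
  then show ?thesis by (simp add: order_ring_def)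
qed

end

section \<open>Lattice points of bounded norm, and units\<close>

lemma common_denominator:
  assumes "finite (S :: rat set)"
  shows "\<exists>N>0::nat. \<forall>q\<in>S. of_nat N * q \<in> \<int>"
  using assms
proof (induction S rule: finite_induct)
  case (insert q S)
  then obtain N :: nat where N: "N > 0" "\<forall>q\<in>S. of_nat N * q \<in> \<int>" by auto
  obtain a d :: int where q: "q = of_int a / of_int d" "d > 0"
    by (metis Fract_of_int_quotient Rat_cases)
  have "of_nat (nat d * N) * q = of_int (a * int N)" using q by simp
  then have "of_nat (nat d * N) * q \<in> \<int>" by (simp only: Ints_of_int)
  moreover have "of_nat (nat d * N) * r \<in> \<int>" if "r \<in> S" for r
    using N(2) that Ints_mult[of "of_nat (nat d)" "of_nat N * r"] by (simp add: mult.assoc)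
  ultimately show ?case using N(1) q(2) by (intro exI[of _ "nat d * N"]) auto
qed auto

context real_embeddings
begin

text \<open>The factor \<open>N\<close> will be a common denominator of the structure constants
  \<open>coord (b i * b j) l\<close>, which puts all these points into
  \<open>order_ring\<close>.\<close>

definition lattice_elt :: "nat \<Rightarrow> ('n \<Rightarrow> int) \<Rightarrow> 'k" where
  "lattice_elt N a = of_nat N * (\<Sum>i\<in>UNIV. of_int (a i) * b i)"

lemma lattice_scale_exists: "\<exists>N>0. \<forall>i. of_nat N * b i \<in> order_ring"
proof -
  obtain N :: nat where N: "N > 0" "\<forall>q\<in>(\<lambda>(i, j, l). coord (b i * b j) l) ` UNIV. of_nat N * q \<in> \<int>"
    using common_denominator[of "(\<lambda>(i, j, l). coord (b i * b j) l) ` UNIV"] by auto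
  have "coord (of_nat N * b i * b j) l \<in> \<int>" for i j l
    using N(2) coord_scale[of "of_nat N" "b i * b j" l] by (simp add: mult.assoc)
  then show ?thesis using N(1) by (auto simp: order_ring_def)
qed

lemma lattice_elt_in_order_ring:
  assumes "\<forall>i. of_nat N * b i \<in> order_ring"
  shows "lattice_elt N a \<in> order_ring"
proof -
  have "lattice_elt N a = (\<Sum>i\<in>UNIV. of_int (a i) * (of_nat N * b i))"
    by (simp add: lattice_elt_def sum_distrib_left mult.left_commute)
  then show ?thesis
    using assms by (auto intro!: order_ring_sum order_ring_mult[OF order_ring_of_int])
qed

lemma lattice_elt_diff: "lattice_elt N (\<lambda>i. a i - a' i) = lattice_elt N a - lattice_elt N a'"
  by (simp add: lattice_elt_def left_diff_distrib sum_subtractf right_diff_distrib)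

lemma lattice_elt_scale: "lattice_elt N (\<lambda>i. c * a i) = of_int c * lattice_elt N a"
  by (simp add: lattice_elt_def sum_distrib_left mult_ac)

lemma lattice_elt_eq_0:
  assumes "N > 0" "lattice_elt N a = 0"
  shows "a i = 0"
proof -
  have "coord (lattice_elt N a) i = of_nat N * (\<Sum>j\<in>UNIV. of_int (a j) * (if i = j then 1 else 0))"
    using coord_scale[of "of_nat N"] coord_scale[of "of_int _"]
    by (simp add: lattice_elt_def coord_sum coord_basis cong: if_cong)
  moreover have "coord 0 i = 0" using coord_scale[of 0 0 i] by simp
  ultimately show ?thesis
    using assms by (simp add: if_distrib[of "\<lambda>c. _ * c"] cong: if_cong)
qed

lemma lattice_elt_inj:
  assumes "N > 0" "lattice_elt N a = lattice_elt N a'"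
  shows "a = a'"
  using lattice_elt_eq_0[OF assms(1), of "\<lambda>i. a i - a' i"] assms(2) by (auto simp: lattice_elt_diff)

text \<open>Dirichlet's box principle, with \<open>(q^(n-1) + 1)^n\<close> lattice points in \<open>(q^n)^(n-1)\<close> boxes.\<close>

lemma lattice_elt_small:
  assumes C: "\<And>a l M. (\<And>i. \<bar>a i\<bar> \<le> M) \<Longrightarrow> \<bar>\<sigma> l (lattice_elt N a)\<bar> \<le> C * real_of_int M"
    and "q > 0" and "C > 0"
  shows "\<exists>a. a \<noteq> (\<lambda>_. 0) \<and> (\<forall>l. l \<noteq> l0 \<longrightarrow> \<bar>\<sigma> l (lattice_elt N a)\<bar> \<le> 4 * C / real q)
    \<and> \<bar>\<sigma> l0 (lattice_elt N a)\<bar> \<le> 4 * C * real q ^ (CARD('n) - 1)"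
proof -
  define n where "n = CARD('n)"
  define M :: nat where "M = q ^ (n - 1)"
  have "n > 0" by (simp add: n_def)
  then have qM: "q ^ n = q * M" unfolding M_def by (metis Suc_diff_1 power_Suc)
  have "M > 0" using assms by (simp add: M_def)
  \<comment> \<open>\<open>box\<close> cuts the interval of radius 2CM about 0 into q^n cells. The
    conjugates are bounded by CM; the slack keeps the index strictly below q^n.\<close>
  define box where "box v = \<lfloor>(v + 2 * C * M) * real (q ^ n) / (4 * C * M)\<rfloor>" for v :: real
  define f where "f a = restrict (\<lambda>l. box (\<sigma> l (lattice_elt N a))) (UNIV - {l0})" for a :: "'n \<Rightarrow> int"
  define D where "D = PiE (UNIV :: 'n set) (\<lambda>_. {0..int M})"
  have bound: "\<bar>\<sigma> l (lattice_elt N a)\<bar> \<le> C * M" if "a \<in> D" for a l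
    using C[of a "int M" l] that by (auto simp: D_def PiE_def Pi_def)
  have "f ` D \<subseteq> PiE (UNIV - {l0}) (\<lambda>_. {0..<int (q ^ n)})"
  proof
    fix g assume "g \<in> f ` D"
    then obtain a where a: "a \<in> D" "g = f a" by auto
    have "box (\<sigma> l (lattice_elt N a)) \<in> {0..<int (q ^ n)}" for l
    proof -
      let ?v = "\<sigma> l (lattice_elt N a)"
      have CM: "C * M > 0" using assms \<open>M > 0\<close> by simp
      have v: "0 \<le> ?v + 2 * C * M" "?v + 2 * C * M < 4 * C * M"
        using bound[OF a(1), of l] CM by auto
      have "(?v + 2 * C * M) * real (q ^ n) / (4 * C * M) < real (q ^ n)"
        using v CM assms by (simp add: divide_less_eq)
      moreover have "0 \<le> (?v + 2 * C * M) * real (q ^ n) / (4 * C * M)"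
        using v CM \<open>C > 0\<close> by (intro divide_nonneg_nonneg mult_nonneg_nonneg) auto
      ultimately show ?thesis unfolding box_def by (simp add: floor_less_iff)
    qed
    then show "g \<in> PiE (UNIV - {l0}) (\<lambda>_. {0..<int (q ^ n)})"
      unfolding a(2) f_def by auto
  qed
  then have "card (f ` D) \<le> card (PiE (UNIV - {l0}) (\<lambda>_. {0..<int (q ^ n)}))"
    by (intro card_mono finite_PiE) auto
  also have "\<dots> = (q ^ n) ^ (n - 1)"
    by (simp add: card_PiE n_def card_Diff_singleton nat_power_eq)
  also have "\<dots> = M ^ n" by (simp add: M_def mult.commute flip: power_mult)
  also have "\<dots> < (M + 1) ^ n" using \<open>n > 0\<close> by (intro power_strict_mono) auto
  also have "\<dots> = card D" by (simp add: D_def card_PiE n_def nat_add_distrib)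
  finally obtain a a' where aa: "a \<in> D" "a' \<in> D" "a \<noteq> a'" "f a = f a'"
    using pigeonhole[of f D] by (auto simp: inj_on_def)
  define c where "c i = a i - a' i" for i
  have \<sigma>c: "\<sigma> l (lattice_elt N c) = \<sigma> l (lattice_elt N a) - \<sigma> l (lattice_elt N a')" for l
    unfolding c_def by (simp add: lattice_elt_diff emb_diff)
  have "c \<noteq> (\<lambda>_. 0)" using aa(3) by (auto simp: c_def fun_eq_iff)
  moreover have "\<bar>\<sigma> l (lattice_elt N c)\<bar> \<le> 4 * C / real q" if "l \<noteq> l0" for l
  proof -
    let ?v = "\<sigma> l (lattice_elt N a)" and ?v' = "\<sigma> l (lattice_elt N a')"
    \<comment> \<open>1/K is the width of a cell. It equals 4C/q because q^n = q M.\<close>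
    define K where "K = real (q ^ n) / (4 * C * M)"
    have K: "K = real q / (4 * C)" using \<open>M > 0\<close> by (simp add: K_def qM)
    have "box ?v = box ?v'" using fun_cong[OF aa(4), of l] that by (simp add: f_def)
    then have "\<bar>(?v + 2 * C * M) * K - (?v' + 2 * C * M) * K\<bar> < 1"
      unfolding box_def K_def times_divide_eq_right by linarith
    then have "\<bar>(?v - ?v') * K\<bar> < 1" by (simp add: algebra_simps)
    then have "\<bar>?v - ?v'\<bar> * K < 1" using K assms by (simp add: abs_mult)
    then show ?thesis using assms by (simp add: K \<sigma>c field_simps)
  qed
  moreover have "\<bar>\<sigma> l0 (lattice_elt N c)\<bar> \<le> 4 * C * real q ^ (CARD('n) - 1)"
  proof -
    have "\<bar>\<sigma> l0 (lattice_elt N c)\<bar> \<le> C * M + C * M"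
      using bound[OF aa(1), of l0] bound[OF aa(2), of l0] by (simp add: \<sigma>c)
    also have "\<dots> \<le> 4 * C * M" using assms by simp
    finally show ?thesis by (simp add: M_def n_def)
  qed
  ultimately show ?thesis by blast
qed

lemma lattice_elt_bound:
  obtains C where "C > 0"
    "\<And>a l M. (\<And>i. \<bar>a i\<bar> \<le> M) \<Longrightarrow> \<bar>\<sigma> l (lattice_elt N a)\<bar> \<le> C * real_of_int M"
proof
  define C where "C = 1 + N * (\<Sum>l\<in>UNIV. \<Sum>i\<in>UNIV. \<bar>\<sigma> l (b i)\<bar>)"
  show "C > 0" unfolding C_def by (intro add_pos_nonneg mult_nonneg_nonneg sum_nonneg) auto
  fix a :: "'n \<Rightarrow> int" and l M assume a: "\<And>i. \<bar>a i\<bar> \<le> M"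
  then have "M \<ge> 0" by (meson abs_ge_zero order_trans)
  have "\<bar>\<sigma> l (lattice_elt N a)\<bar> = N * \<bar>\<Sum>i\<in>UNIV. of_int (a i) * \<sigma> l (b i)\<bar>"
    by (simp add: lattice_elt_def emb_mult emb_sum emb_of_nat emb_of_int abs_mult)
  also have "\<dots> \<le> N * (\<Sum>i\<in>UNIV. M * \<bar>\<sigma> l (b i)\<bar>)"
  proof (intro mult_left_mono order_trans[OF sum_abs] sum_mono)
    show "\<bar>of_int (a i) * \<sigma> l (b i)\<bar> \<le> M * \<bar>\<sigma> l (b i)\<bar>" for i
      using a[of i] by (simp add: abs_mult mult_right_mono flip: of_int_abs)
  qed auto
  also have "\<dots> = N * (\<Sum>i\<in>UNIV. \<bar>\<sigma> l (b i)\<bar>) * M" by (simp add: sum_distrib_left mult_ac)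
  also have "\<dots> \<le> C * M"
  proof (rule mult_right_mono)
    have "(\<Sum>i\<in>UNIV. \<bar>\<sigma> l (b i)\<bar>) \<le> (\<Sum>l\<in>UNIV. \<Sum>i\<in>UNIV. \<bar>\<sigma> l (b i)\<bar>)"
      by (rule member_le_sum) (auto intro: sum_nonneg)
    then have "N * (\<Sum>i\<in>UNIV. \<bar>\<sigma> l (b i)\<bar>) \<le> N * (\<Sum>l\<in>UNIV. \<Sum>i\<in>UNIV. \<bar>\<sigma> l (b i)\<bar>)"
      by (intro mult_left_mono) auto
    then show "N * (\<Sum>i\<in>UNIV. \<bar>\<sigma> l (b i)\<bar>) \<le> C" by (simp add: C_def)
  qed (use \<open>M \<ge> 0\<close> in simp)
  finally show "\<bar>\<sigma> l (lattice_elt N a)\<bar> \<le> C * real_of_int M" .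
qed

text \<open>The box principle bounds one conjugate by 4C q^(n-1) and the others by 4C/q, so the norm
  is at most (4C)^n for every q. With only finitely many such points, the conjugate at
  \<open>l1\<close> would be bounded away from 0, which a large q contradicts.\<close>

lemma infinite_bounded_norm:
  assumes "CARD('n) \<ge> 2" "N > 0"
  shows "\<exists>P::nat. infinite {a. a \<noteq> (\<lambda>_. 0) \<and> \<bar>\<Prod>l\<in>UNIV. \<sigma> l (lattice_elt N a)\<bar> \<le> P}"
proof -
  obtain C where C: "C > 0"
    "\<And>a l M. (\<And>i. \<bar>a i\<bar> \<le> M) \<Longrightarrow> \<bar>\<sigma> l (lattice_elt N a)\<bar> \<le> C * real_of_int M"
    by (rule lattice_elt_bound[of N]) blast
  obtain P :: nat where P: "(4 * C) ^ CARD('n) \<le> P" using real_arch_simple by blast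
  let ?A = "{a. a \<noteq> (\<lambda>_. 0) \<and> \<bar>\<Prod>l\<in>UNIV. \<sigma> l (lattice_elt N a)\<bar> \<le> P}"
  \<comment> \<open>The degree assumption enters here: it supplies an embedding other than
    \<open>l0\<close>, whose value can be made small.\<close>
  obtain l0 l1 :: 'n where l: "l1 \<noteq> l0"
    using assms(1) by (metis UNIV_I card_le_Suc0_iff_eq finite_class.finite_UNIV not_less_eq_eq numeral_2_eq_2)
  have "infinite ?A"
  proof
    assume fin: "finite ?A"
    let ?V = "insert 1 ((\<lambda>a. \<bar>\<sigma> l1 (lattice_elt N a)\<bar>) ` ?A)"
    define \<delta> where "\<delta> = Min ?V"
    have "\<sigma> l1 (lattice_elt N a) \<noteq> 0" if "a \<in> ?A" for a
      using that lattice_elt_eq_0[OF assms(2), of a] by auto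
    then have "\<delta> > 0" unfolding \<delta>_def using fin by (subst Min_gr_iff) auto
    obtain q :: nat where q: "4 * C / \<delta> < q" using reals_Archimedean2 by blast
    moreover have "4 * C / \<delta> > 0" using C \<open>\<delta> > 0\<close> by simp
    ultimately have "q > 0" by (metis less_trans of_nat_0_less_iff)
    obtain a where a: "a \<noteq> (\<lambda>_. 0)" "\<forall>l. l \<noteq> l0 \<longrightarrow> \<bar>\<sigma> l (lattice_elt N a)\<bar> \<le> 4 * C / real q"
      "\<bar>\<sigma> l0 (lattice_elt N a)\<bar> \<le> 4 * C * real q ^ (CARD('n) - 1)"
      using lattice_elt_small[OF C(2) \<open>q > 0\<close> C(1), of l0] by blast
    have "\<bar>\<Prod>l\<in>UNIV. \<sigma> l (lattice_elt N a)\<bar>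
        = \<bar>\<sigma> l0 (lattice_elt N a)\<bar> * (\<Prod>l\<in>UNIV - {l0}. \<bar>\<sigma> l (lattice_elt N a)\<bar>)"
      by (simp add: abs_mult abs_prod prod.remove[of UNIV l0])
    also have "\<dots> \<le> (4 * C * real q ^ (CARD('n) - 1)) * (\<Prod>l\<in>UNIV - {l0}. 4 * C / real q)"
      using a C by (intro mult_mono prod_mono prod_nonneg) auto
    also have "\<dots> = (4 * C) ^ CARD('n)"
    proof -
      have "4 * C * (4 * C) ^ (CARD('n) - 1) = (4 * C) ^ CARD('n)"
        by (metis Suc_diff_1 power_Suc zero_less_card_finite)
      then show ?thesis using \<open>q > 0\<close> by (simp add: card_Diff_singleton power_divide)
    qed
    also note P
    finally have "a \<in> ?A" using a(1) by simp
    then have "\<delta> \<le> \<bar>\<sigma> l1 (lattice_elt N a)\<bar>"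
      unfolding \<delta>_def using fin by (intro Min_le) auto
    also have "\<dots> \<le> 4 * C / q" using a(2) l by simp
    also have "\<dots> < \<delta>" using q \<open>\<delta> > 0\<close> \<open>q > 0\<close> by (simp add: field_simps)
    finally show False by simp
  qed
  then show ?thesis by blast
qed

text \<open>Among infinitely many points of bounded norm, two share the norm m and all coefficients
  modulo 4 P!. Their difference is 4m times an element of the order, and m/x and m/y lie in the
  order, so x/y and y/x are both congruent to 1 modulo 4. The modulus 4 is what makes (1 - u)/2
  twice an element of the order.\<close>

lemma unit_congruent_1_mod_4:
  assumes "CARD('n) \<ge> 2"
  obtains u s where "u = 1 - 4 * s" "s \<in> order_ring" "u \<in> order_ring" "inverse u \<in> order_ring"
    "u \<noteq> 0" "u\<^sup>2 \<noteq> 1"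
proof -
  obtain N where N: "N > 0" "\<forall>i. of_nat N * b i \<in> order_ring" using lattice_scale_exists by blast
  define nrm where "nrm x = (\<Prod>l\<in>UNIV. \<sigma> l x)" for x
  obtain P :: nat where "infinite {a. a \<noteq> (\<lambda>_. 0) \<and> \<bar>nrm (lattice_elt N a)\<bar> \<le> P}" (is "infinite ?A")
    using infinite_bounded_norm[OF assms N(1)] unfolding nrm_def by blast
  \<comment> \<open>Every possible common norm m is nonzero with |m| at most P, so 4m divides
    \<open>D\<close>.\<close>
  define D where "D = 4 * (fact P :: int)"
  define g where "g a = (nrm (lattice_elt N a), \<lambda>i. a i mod D)" for a
  have L: "lattice_elt N a \<in> order_ring" for a by (rule lattice_elt_in_order_ring[OF N(2)])
  have "D > 0" by (simp add: D_def)
  have "g ` ?A \<subseteq> (of_int ` {- int P..int P}) \<times> PiE UNIV (\<lambda>_. {0..<D})"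
  proof
    fix p assume "p \<in> g ` ?A"
    then obtain a where a: "a \<in> ?A" "p = g a" by auto
    obtain m where m: "nrm (lattice_elt N a) = of_int m"
      using norm_in_Ints[OF L[of a]] by (auto simp: nrm_def elim: Ints_cases)
    then have "\<bar>real_of_int m\<bar> \<le> P" using a by simp
    then have "m \<in> {- int P..int P}" by auto
    then show "p \<in> (of_int ` {- int P..int P}) \<times> PiE UNIV (\<lambda>_. {0..<D})"
      using m \<open>D > 0\<close> by (auto simp: a(2) g_def)
  qed
  then have "finite (g ` ?A)" by (rule finite_subset) (intro finite_cartesian_product finite_PiE finite_imageI; simp)
  then obtain a0 where a0: "a0 \<in> ?A" "infinite {a \<in> ?A. g a = g a0}"
    using pigeonhole_infinite[OF \<open>infinite ?A\<close>] by blast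
  \<comment> \<open>Discarding \<open>a0\<close> and its negative excludes x = y and x = -y, hence
    u^2 = 1.\<close>
  then have "infinite ({a \<in> ?A. g a = g a0} - {a0, \<lambda>i. - 1 * a0 i})" by simp
  then have "{a \<in> ?A. g a = g a0} - {a0, \<lambda>i. - 1 * a0 i} \<noteq> {}"
    by (rule infinite_imp_nonempty)
  then obtain a where a: "a \<in> ?A" "g a = g a0" "a \<noteq> a0" "a \<noteq> (\<lambda>i. - 1 * a0 i)"
    by blast
  define x y where "x = lattice_elt N a" and "y = lattice_elt N a0"
  obtain m where m: "nrm y = of_int m"
    using norm_in_Ints[OF L[of a0]] by (auto simp: nrm_def y_def elim: Ints_cases)
  have m': "nrm x = of_int m" using a(2) m by (simp add: g_def x_def y_def)
  have nz: "x \<noteq> 0" "y \<noteq> 0"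
    using a(1) a0(1) lattice_elt_eq_0[OF N(1)] unfolding x_def y_def by blast+
  have "m \<noteq> 0" using m nz(2) by (auto simp: nrm_def)
  have "\<bar>real_of_int m\<bar> \<le> P" using a0 m by (simp add: y_def)
  then have "nat \<bar>m\<bar> \<le> P" by linarith
  then have "nat \<bar>m\<bar> dvd fact P" using \<open>m \<noteq> 0\<close> by (intro dvd_fact) auto
  then have "int (nat \<bar>m\<bar>) dvd int (fact P)" by (simp only: int_dvd_int_iff)
  then have "m dvd fact P" by simp
  then obtain r where r: "D = 4 * m * r" by (auto simp: D_def)
  define c where "c i = (a i - a0 i) div D" for i
  have "a i - a0 i = D * c i" for i
  proof -
    have "a i mod D = a0 i mod D" using a(2) by (metis g_def prod.inject)
    then have "D dvd a i - a0 i" by (simp add: mod_eq_dvd_iff)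
    then show ?thesis by (simp add: c_def)
  qed
  then have "lattice_elt N (\<lambda>i. a i - a0 i) = of_int D * lattice_elt N c"
    by (simp add: lattice_elt_scale)
  then have xy: "x - y = 4 * (of_int m * of_int r * lattice_elt N c)"
    by (simp add: x_def y_def lattice_elt_diff r mult.assoc)
  define s where "s = - (of_int m / y * (of_int r * lattice_elt N c))"
  define s' where "s' = of_int m / x * (of_int r * lattice_elt N c)"
  have my: "of_int m / y \<in> order_ring" and mx: "of_int m / x \<in> order_ring"
    using m m' nz L unfolding nrm_def x_def y_def by (auto intro!: norm_divide_in_order_ring)
  have s: "s \<in> order_ring" and s': "s' \<in> order_ring"
    unfolding s_def s'_def
    by (intro order_ring_uminus order_ring_mult my mx order_ring_of_int L)+
  have u: "x / y = 1 - 4 * s" and u': "inverse (x / y) = 1 - 4 * s'"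
  proof -
    have "x / y = 1 + (x - y) / y" "inverse (x / y) = 1 - (x - y) / x"
      using nz by (simp_all add: field_simps)
    then show "x / y = 1 - 4 * s" "inverse (x / y) = 1 - 4 * s'"
      by (simp_all add: xy s_def s'_def)
  qed
  show thesis
  proof (rule that[of "x / y" s])
    show "x / y \<in> order_ring" "inverse (x / y) \<in> order_ring"
      by (subst u u', intro order_ring_diff order_ring_mult order_ring_1 order_ring_numeral s s')+
    show "(x / y)\<^sup>2 \<noteq> 1"
    proof
      assume "(x / y)\<^sup>2 = 1"
      then have "x\<^sup>2 = y\<^sup>2" using nz by (simp add: power_divide)
      then have "x = y \<or> x = of_int (- 1) * y" by (simp add: power2_eq_iff)
      then show False
        using a(3,4) lattice_elt_inj[OF N(1)] unfolding x_def y_def lattice_elt_scale[symmetric] by blast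
    qed
  qed (use u s nz in auto)
qed

end

section \<open>The Fourier transform of a Gaussian\<close>

lemma integrable_gaussian_moment:
  fixes a :: real
  assumes "a > 0"
  shows "integrable lborel (\<lambda>x. exp (- a * x\<^sup>2) * x ^ k)"
proof -
  define s where "s = sqrt (1 / (2 * a))"
  have s: "s > 0" "s\<^sup>2 = 1 / (2 * a)" using assms by (simp_all add: s_def)
  have "integrable lborel (\<lambda>x. sqrt (2 * pi * s\<^sup>2) * (normal_density 0 s x * (x - 0) ^ k))"
    using integrable_normal_moment[OF s(1)] by (rule integrable_mult_right)
  also have "(\<lambda>x. sqrt (2 * pi * s\<^sup>2) * (normal_density 0 s x * (x - 0) ^ k)) = (\<lambda>x. exp (- a * x\<^sup>2) * x ^ k)"
    using assms s(1) by (simp add: normal_density_def fun_eq_iff s(2))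
  finally show ?thesis .
qed

text \<open>The branch of (- \<i> z)^(-1/2) that is positive on the positive imaginary axis; it is
  holomorphic because - \<i> z has positive real part on the upper half plane.\<close>

definition ft_factor :: "complex \<Rightarrow> complex" where
  "ft_factor z = 1 / csqrt (- \<i> * z)"

definition gaussian_1d :: "complex \<Rightarrow> real \<Rightarrow> complex" where
  "gaussian_1d z x = exp (complex_of_real pi * \<i> * z * (complex_of_real x)\<^sup>2)"

abbreviation fourier_char :: "real \<Rightarrow> real \<Rightarrow> complex" where
  "fourier_char \<xi> x \<equiv> exp (- 2 * complex_of_real pi * \<i> * complex_of_real (x * \<xi>))"

lemma norm_fourier_char [simp]: "norm (fourier_char \<xi> x) = 1"
  by (simp add: norm_exp_eq_Re)

lemma norm_gaussian_1d: "norm (gaussian_1d z x) = exp (- (pi * Im z) * x\<^sup>2)"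
  by (simp add: gaussian_1d_def norm_exp_eq_Re flip: of_real_power)

lemma gaussian_1d_measurable [measurable]: "gaussian_1d z \<in> borel_measurable borel"
  unfolding gaussian_1d_def by (intro borel_measurable_continuous_onI continuous_intros)

lemma fourier_char_measurable [measurable]: "fourier_char \<xi> \<in> borel_measurable borel"
  by (intro borel_measurable_continuous_onI continuous_intros)

lemma integrable_gaussian_1d_moment:
  assumes "Im z > 0"
  shows "integrable lborel (\<lambda>x. gaussian_1d z x * fourier_char \<xi> x * complex_of_real x ^ k)"
proof (rule Bochner_Integration.integrable_bound)
  show "integrable lborel (\<lambda>x. exp (- (pi * Im z) * x\<^sup>2) * x ^ k)"
    using assms by (intro integrable_gaussian_moment) simp
qed (auto simp: norm_mult norm_gaussian_1d norm_power abs_mult power_abs)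

definition gaussian_1d_ft :: "real \<Rightarrow> complex \<Rightarrow> complex" where
  "gaussian_1d_ft \<xi> z = (LINT x|lborel. gaussian_1d z x * fourier_char \<xi> x)"

text \<open>Second order remainder of the exponential series. The bound on \<open>h\<close> lets the
  factor exp |Re w| consume at most half of the Gaussian decay, so one integrable function times
  |h|^2 serves for all such \<open>h\<close>.\<close>

lemma gaussian_1d_taylor:
  assumes "norm h \<le> Im z / 2"
  shows "norm (gaussian_1d (z + h) x - gaussian_1d z x - h * (complex_of_real pi * \<i> * (complex_of_real x)\<^sup>2 * gaussian_1d z x))
    \<le> (norm h)\<^sup>2 * (pi\<^sup>2 * (exp (- (pi * Im z / 2) * x\<^sup>2) * x ^ 4))"
proof -
  define w where "w = complex_of_real pi * \<i> * h * (complex_of_real x)\<^sup>2"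
  have w: "norm w = pi * norm h * x\<^sup>2" by (simp add: w_def norm_mult norm_power)
  have "gaussian_1d (z + h) x - gaussian_1d z x - h * (complex_of_real pi * \<i> * (complex_of_real x)\<^sup>2 * gaussian_1d z x)
      = gaussian_1d z x * (exp w - (\<Sum>k\<le>1. w ^ k / fact k))"
    by (simp add: gaussian_1d_def w_def algebra_simps flip: exp_add)
  also have "norm \<dots> \<le> exp (- (pi * Im z) * x\<^sup>2) * (exp (pi * (Im z / 2) * x\<^sup>2) * (norm w)\<^sup>2)"
    unfolding norm_mult norm_gaussian_1d
  proof (intro mult_left_mono)
    have "norm (exp w - (\<Sum>k\<le>1. w ^ k / fact k)) \<le> exp \<bar>Re w\<bar> * (norm w)\<^sup>2"
      using Taylor_exp[of w 1] by (simp add: numeral_2_eq_2)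
    also have "\<dots> \<le> exp (pi * (Im z / 2) * x\<^sup>2) * (norm w)\<^sup>2"
    proof (intro mult_right_mono)
      have "\<bar>Re w\<bar> \<le> norm w" by (rule abs_Re_le_cmod)
      also have "\<dots> \<le> pi * (Im z / 2) * x\<^sup>2"
        unfolding w using assms by (intro mult_right_mono mult_left_mono) auto
      finally show "exp \<bar>Re w\<bar> \<le> exp (pi * (Im z / 2) * x\<^sup>2)" by simp
    qed auto
    finally show "norm (exp w - (\<Sum>k\<le>1. w ^ k / fact k)) \<le> exp (pi * (Im z / 2) * x\<^sup>2) * (norm w)\<^sup>2" .
  qed auto
  also have "\<dots> = (norm h)\<^sup>2 * (pi\<^sup>2 * (exp (- (pi * Im z) * x\<^sup>2) * exp (pi * (Im z / 2) * x\<^sup>2) * x ^ 4))"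
    by (simp add: w power_mult_distrib mult_ac flip: power_mult)
  also have "exp (- (pi * Im z) * x\<^sup>2) * exp (pi * (Im z / 2) * x\<^sup>2) = exp (- (pi * Im z / 2) * x\<^sup>2)"
    unfolding exp_add[symmetric] by (simp add: algebra_simps)
  finally show ?thesis .
qed

text \<open>Differentiation under the integral sign: integrating the Taylor bound shows that the
  difference quotient differs from the candidate \<open>d\<close> by at most |h| K.\<close>

lemma gaussian_1d_ft_holomorphic: "gaussian_1d_ft \<xi> holomorphic_on {z. Im z > 0}"
proof (rule holomorphic_onI)
  fix z assume "z \<in> {z. Im z > 0}"
  then have z: "Im z > 0" by simp
  define g where "g x = complex_of_real pi * \<i> * (complex_of_real x)\<^sup>2 * gaussian_1d z x" for x
  define d where "d = (LINT x|lborel. g x * fourier_char \<xi> x)"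
  define K where "K = (LINT x|lborel. pi\<^sup>2 * (exp (- (pi * Im z / 2) * x\<^sup>2) * x ^ 4))"
  have "(\<lambda>x. g x * fourier_char \<xi> x)
      = (\<lambda>x. complex_of_real pi * \<i> * (gaussian_1d z x * fourier_char \<xi> x * (complex_of_real x)\<^sup>2))"
    unfolding g_def by (intro ext) algebra
  then have int_g: "integrable lborel (\<lambda>x. g x * fourier_char \<xi> x)"
    using integrable_mult_right[OF integrable_gaussian_1d_moment[OF z, of \<xi> 2], of "complex_of_real pi * \<i>"]
    by (simp only:)
  have int: "integrable lborel (\<lambda>x. gaussian_1d w x * fourier_char \<xi> x)" if "Im w > 0" for w
    using integrable_gaussian_1d_moment[OF that, of \<xi> 0] by simp
  have bound: "norm ((gaussian_1d_ft \<xi> (z + h) - gaussian_1d_ft \<xi> z) / h - d) \<le> norm h * K"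
    if h: "norm h < Im z / 2" "h \<noteq> 0" for h
  proof -
    have "\<bar>Im h\<bar> < Im z / 2" using abs_Im_le_cmod[of h] h(1) by linarith
    then have zh: "Im (z + h) > 0" using z by auto
    have eq: "(\<lambda>x. (gaussian_1d (z + h) x - gaussian_1d z x - h * g x) * fourier_char \<xi> x)
        = (\<lambda>x. gaussian_1d (z + h) x * fourier_char \<xi> x - gaussian_1d z x * fourier_char \<xi> x - h * (g x * fourier_char \<xi> x))"
      by (intro ext) algebra
    have comb: "integrable lborel (\<lambda>x. A x - B x - h * D x)"
      "(LINT x|lborel. A x - B x - h * D x) = (LINT x|lborel. A x) - (LINT x|lborel. B x) - h * (LINT x|lborel. D x)"
      if "integrable lborel A" "integrable lborel B" "integrable lborel D" for A B D :: "real \<Rightarrow> complex"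
      using that by simp_all
    note comb = comb[OF int[OF zh] int[OF z] int_g, folded eq]
    have "gaussian_1d_ft \<xi> (z + h) - gaussian_1d_ft \<xi> z - h * d
        = (LINT x|lborel. (gaussian_1d (z + h) x - gaussian_1d z x - h * g x) * fourier_char \<xi> x)"
      unfolding gaussian_1d_ft_def d_def by (rule comb(2)[symmetric])
    also have "norm \<dots> \<le> (LINT x|lborel. (norm h)\<^sup>2 * (pi\<^sup>2 * (exp (- (pi * Im z / 2) * x\<^sup>2) * x ^ 4)))"
    proof (rule order_trans[OF integral_norm_bound Bochner_Integration.integral_mono])
      show "integrable lborel (\<lambda>x. norm ((gaussian_1d (z + h) x - gaussian_1d z x - h * g x) * fourier_char \<xi> x))"
        by (intro integrable_norm comb(1))
      show "integrable lborel (\<lambda>x. (norm h)\<^sup>2 * (pi\<^sup>2 * (exp (- (pi * Im z / 2) * x\<^sup>2) * x ^ 4)))"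
        using z by (intro integrable_mult_right integrable_gaussian_moment) simp
    qed (use gaussian_1d_taylor[of h z] h in \<open>simp add: norm_mult g_def\<close>)
    also have "\<dots> = (norm h)\<^sup>2 * K" by (simp add: K_def)
    finally have "norm (gaussian_1d_ft \<xi> (z + h) - gaussian_1d_ft \<xi> z - h * d) / norm h \<le> norm h * K"
      using h(2) by (simp add: divide_le_eq power2_eq_square mult_ac)
    then show ?thesis using h(2) by (simp add: norm_divide[symmetric] diff_divide_distrib)
  qed
  have "((\<lambda>h. (gaussian_1d_ft \<xi> (z + h) - gaussian_1d_ft \<xi> z) / h - d) \<longlongrightarrow> 0) (at 0)"
  proof (rule Lim_null_comparison)
    show "\<forall>\<^sub>F h in at 0. norm ((gaussian_1d_ft \<xi> (z + h) - gaussian_1d_ft \<xi> z) / h - d) \<le> norm h * K"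
      unfolding eventually_at using bound z by (intro exI[of _ "Im z / 2"]) auto
    have "((\<lambda>h::complex. norm h * K) \<longlongrightarrow> norm (0 :: complex) * K) (at 0)"
      by (rule tendsto_mult[OF tendsto_norm[OF tendsto_ident_at] tendsto_const])
    then show "((\<lambda>h::complex. norm h * K) \<longlongrightarrow> 0) (at 0)" by simp
  qed
  then have "(gaussian_1d_ft \<xi> has_field_derivative d) (at z)"
    by (simp add: DERIV_def LIM_zero_iff)
  then show "gaussian_1d_ft \<xi> field_differentiable at z within {z. Im z > 0}"
    by (auto simp: field_differentiable_def intro: has_field_derivative_at_within)
qed

lemma ft_factor_domain:
  assumes "Im z > 0"
  shows "- \<i> * z \<notin> \<real>\<^sub>\<le>\<^sub>0" and "Re (- \<i> * z) > 0"
  using assms by (auto simp: complex_nonpos_Reals_iff)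

lemma ft_factor_holomorphic: "ft_factor holomorphic_on {z. Im z > 0}"
  unfolding ft_factor_def
  by (intro holomorphic_intros) (use ft_factor_domain in auto)

lemma ft_factor_square: "Im z > 0 \<Longrightarrow> (ft_factor z)\<^sup>2 = 1 / (- \<i> * z)"
  by (simp add: ft_factor_def power_divide)

lemma ft_factor_nonzero: "Im z > 0 \<Longrightarrow> ft_factor z \<noteq> 0"
  using ft_factor_square[of z] by auto

text \<open>On the right half plane the principal square root commutes with inversion, and - \<i>
  (-1/z) is the inverse of - \<i> z. This makes the Fourier transform an involution on
  Gaussians.\<close>

lemma ft_factor_involution:
  assumes "Im z > 0"
  shows "ft_factor z * ft_factor (- 1 / z) = 1"
proof -
  have "z \<noteq> 0" using assms by auto
  have "inverse (- \<i> * z) = - \<i> * (- 1 / z)"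
    by (rule inverse_unique) (use \<open>z \<noteq> 0\<close> in simp)
  then have "csqrt (- \<i> * (- 1 / z)) = csqrt (inverse (- \<i> * z))"
    by simp
  also have "\<dots> = inverse (csqrt (- \<i> * z))"
    by (rule csqrt_inverse) (use ft_factor_domain[OF assms] in auto)
  finally show ?thesis using \<open>z \<noteq> 0\<close> by (simp add: ft_factor_def)
qed

text \<open>For z = \<i> t the Gaussian is a rescaled normal density, so its transform comes from
  the characteristic function of the standard normal distribution.\<close>

lemma gaussian_1d_ft_imaginary:
  assumes "t > 0"
  shows "gaussian_1d_ft \<xi> (\<i> * of_real t) = ft_factor (\<i> * of_real t) * gaussian_1d (- 1 / (\<i> * of_real t)) \<xi>"
proof -
  \<comment> \<open>Replacing x by c x turns x^2/2 into pi t x^2, and \<open>s\<close> is chosen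
    such that s c = - 2 pi \<xi>.\<close>
  define c where "c = sqrt (2 * pi * t)"
  have c: "c > 0" "c\<^sup>2 = 2 * pi * t" using assms by (simp_all add: c_def)
  define s where "s = - 2 * pi * \<xi> / c"
  have "complex_of_real (exp (- (s\<^sup>2) / 2)) = (CLINT x|std_normal_distribution. iexp (s * x))"
    using char_std_normal_distribution by (simp add: char_def fun_eq_iff)
  also have "\<dots> = (LINT x|lborel. std_normal_density x *\<^sub>R iexp (s * x))"
    by (subst integral_density) auto
  also have "\<dots> = \<bar>c\<bar> *\<^sub>R (LINT x|lborel. std_normal_density (0 + c * x) *\<^sub>R iexp (s * (0 + c * x)))"
    by (rule lborel_integral_real_affine) (use c in simp)
  also have "(\<lambda>x. std_normal_density (0 + c * x) *\<^sub>R iexp (s * (0 + c * x)))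
      = (\<lambda>x. complex_of_real (1 / sqrt (2 * pi)) * (gaussian_1d (\<i> * of_real t) x * fourier_char \<xi> x))"
  proof
    fix x
    have "- (c * x)\<^sup>2 / 2 = - pi * t * x\<^sup>2" by (simp add: power_mult_distrib c)
    then have std: "std_normal_density (c * x) = 1 / sqrt (2 * pi) * exp (- pi * t * x\<^sup>2)"
      by (simp only: std_normal_density_def)
    have "complex_of_real (exp (- pi * t * x\<^sup>2)) = gaussian_1d (\<i> * of_real t) x"
      by (simp add: gaussian_1d_def exp_of_real[symmetric] algebra_simps)
    then have dens: "complex_of_real (std_normal_density (c * x))
        = complex_of_real (1 / sqrt (2 * pi)) * gaussian_1d (\<i> * of_real t) x"
      by (simp only: std of_real_mult)
    have "s * (c * x) = - 2 * pi * \<xi> * x" using c by (simp add: s_def)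
    then have fourier_char: "iexp (s * (c * x)) = fourier_char \<xi> x" by (simp add: mult_ac)
    show "std_normal_density (0 + c * x) *\<^sub>R iexp (s * (0 + c * x))
      = complex_of_real (1 / sqrt (2 * pi)) * (gaussian_1d (\<i> * of_real t) x * fourier_char \<xi> x)"
      by (simp only: add_0_left scaleR_conv_of_real dens fourier_char mult.assoc)
  qed
  finally have "complex_of_real (exp (- (s\<^sup>2) / 2))
      = complex_of_real (c / sqrt (2 * pi)) * gaussian_1d_ft \<xi> (\<i> * of_real t)"
    using c by (simp add: gaussian_1d_ft_def scaleR_conv_of_real)
  also have "c / sqrt (2 * pi) = sqrt t"
    by (simp add: c_def real_sqrt_mult)
  finally have main: "complex_of_real (exp (- (s\<^sup>2) / 2)) = of_real (sqrt t) * gaussian_1d_ft \<xi> (\<i> * of_real t)" .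
  have "- (s\<^sup>2) / 2 = - pi * \<xi>\<^sup>2 / t"
    using assms by (simp add: s_def power_divide c power_mult_distrib power2_eq_square[of pi])
  then have "complex_of_real (exp (- (s\<^sup>2) / 2)) = complex_of_real (exp (- pi * \<xi>\<^sup>2 / t))"
    by (simp only:)
  also have "\<dots> = gaussian_1d (- 1 / (\<i> * of_real t)) \<xi>"
    using assms by (simp add: gaussian_1d_def exp_of_real[symmetric] field_simps)
  finally have "complex_of_real (exp (- (s\<^sup>2) / 2)) = gaussian_1d (- 1 / (\<i> * of_real t)) \<xi>" .
  moreover have "ft_factor (\<i> * of_real t) = 1 / of_real (sqrt t)"
    using assms by (simp add: ft_factor_def csqrt_of_real_nonneg flip: mult.assoc)
  ultimately show ?thesis using main assms by (simp add: field_simps)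
qed

text \<open>Both sides are holomorphic in z on the upper half plane and agree on the positive
  imaginary axis, so the identity theorem applies.\<close>

lemma gaussian_1d_fourier:
  assumes "Im z > 0"
  shows "(LINT x|lborel. gaussian_1d z x * fourier_char \<xi> x) = ft_factor z * gaussian_1d (- 1 / z) \<xi>"
proof -
  let ?H = "{z. Im z > 0}"
  let ?f = "\<lambda>z. gaussian_1d_ft \<xi> z - ft_factor z * gaussian_1d (- 1 / z) \<xi>"
  have "?f z = 0"
  proof (rule analytic_continuation[where f = ?f and S = ?H and \<xi> = \<i>
        and U = "(\<lambda>t. \<i> * complex_of_real t) ` {0<..}"])
    show "?f holomorphic_on ?H"
      unfolding gaussian_1d_def
      by (intro holomorphic_intros gaussian_1d_ft_holomorphic ft_factor_holomorphic) auto
    show "open ?H" by (rule open_halfspace_Im_gt)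
    show "connected ?H" by (intro convex_connected convex_halfspace_Im_gt)
    show "(\<lambda>t. \<i> * of_real t) ` {0<..} \<subseteq> ?H" by auto
    show "\<i> \<in> ?H" by simp
    show "\<i> islimpt (\<lambda>t. \<i> * of_real t) ` {0<..}"
      unfolding islimpt_approachable
    proof (intro allI impI)
      fix e :: real assume "e > 0"
      moreover have "\<i> * complex_of_real (1 + e / 2) - \<i> = \<i> * of_real (e / 2)"
        by (simp add: algebra_simps)
      ultimately show "\<exists>x'\<in>(\<lambda>t. \<i> * complex_of_real t) ` {0<..}. x' \<noteq> \<i> \<and> dist x' \<i> < e"
        by (intro bexI[of _ "\<i> * of_real (1 + e / 2)"])
          (auto simp: dist_norm norm_mult simp del: of_real_add of_real_divide)
    qed
    show "?f w = 0" if "w \<in> (\<lambda>t. \<i> * of_real t) ` {0<..}" for w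
      using that gaussian_1d_ft_imaginary by auto
  qed (use assms in auto)
  then show ?thesis by (simp add: gaussian_1d_ft_def)
qed

section \<open>From one variable to several, by Fubini\<close>

lemma integral_lborel_prod:
  fixes f :: "'a::euclidean_space \<Rightarrow> real \<Rightarrow> complex"
  assumes "\<And>b. b \<in> Basis \<Longrightarrow> integrable lborel (f b)"
  shows "integrable lborel (\<lambda>x::'a. \<Prod>b\<in>Basis. f b (x \<bullet> b))"
    and "(LINT x|lborel. (\<Prod>b\<in>Basis. f b (x \<bullet> b))) = (\<Prod>b\<in>(Basis::'a set). (LINT x|lborel. f b x))"
proof -
  interpret product_sigma_finite "\<lambda>_::'a. lborel :: real measure" ..
  have [measurable]: "f b \<in> borel_measurable borel" if "b \<in> Basis" for b
    using assms[OF that] by (simp add: borel_measurable_integrable)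
  have eq: "(\<Prod>b\<in>Basis. f b ((\<Sum>b'\<in>Basis. g b' *\<^sub>R b') \<bullet> b)) = (\<Prod>b\<in>Basis. f b (g b))"
    for g :: "'a \<Rightarrow> real"
    by (intro prod.cong) auto
  have m: "(\<lambda>x::'a. \<Prod>b\<in>Basis. f b (x \<bullet> b)) \<in> borel_measurable borel" by measurable
  have m2: "(\<lambda>f. \<Sum>b\<in>Basis. f b *\<^sub>R b) \<in> (\<Pi>\<^sub>M b\<in>Basis. lborel) \<rightarrow>\<^sub>M (borel :: 'a measure)" by measurable
  show "integrable lborel (\<lambda>x::'a. \<Prod>b\<in>Basis. f b (x \<bullet> b))"
    by (subst lborel_eq, subst integrable_distr_eq[OF m2 m], subst eq)
      (rule product_integrable_prod[OF finite_Basis assms])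
  show "(LINT x|lborel. (\<Prod>b\<in>Basis. f b (x \<bullet> b))) = (\<Prod>b\<in>(Basis::'a set). (LINT x|lborel. f b x))"
    by (subst lborel_eq, subst integral_distr[OF m2 m], subst eq)
      (rule product_integral_prod[OF finite_Basis assms])
qed

lemma integral_lborel_vec_prod:
  fixes f :: "'n::finite \<Rightarrow> real \<Rightarrow> complex"
  assumes "\<And>i. integrable lborel (f i)"
  shows "integrable lborel (\<lambda>x::real^'n. \<Prod>i\<in>UNIV. f i (x $ i))"
    and "(LINT x::real^'n|lborel. (\<Prod>i\<in>UNIV. f i (x $ i))) = (\<Prod>i\<in>UNIV. (LINT x|lborel. f i x))"
proof -
  define ax where "ax i = axis i (1::real)" for i :: 'n
  have inj: "inj ax" by (auto simp: inj_def ax_def axis_eq_axis)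
  have B: "Basis = range ax" by (auto simp: ax_def Basis_vec_def)
  have inv: "inv ax (ax i) = i" for i using inj by simp
  have inner: "x \<bullet> ax i = x $ i" for x :: "real^'n" and i
    by (simp add: ax_def cart_eq_inner_axis)
  have *: "(\<Prod>b\<in>Basis. f (inv ax b) (x \<bullet> b)) = (\<Prod>i\<in>UNIV. f i (x $ i))" for x
    unfolding B by (subst prod.reindex[OF inj]) (simp add: inv inner)
  have **: "(\<Prod>b\<in>Basis. (LINT x|lborel. f (inv ax b) x)) = (\<Prod>i\<in>UNIV. (LINT x|lborel. f i x))"
    unfolding B by (subst prod.reindex[OF inj]) (simp add: inv)
  show "integrable lborel (\<lambda>x::real^'n. \<Prod>i\<in>UNIV. f i (x $ i))"
    "(LINT x::real^'n|lborel. (\<Prod>i\<in>UNIV. f i (x $ i))) = (\<Prod>i\<in>UNIV. (LINT x|lborel. f i x))"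
    using integral_lborel_prod[of "\<lambda>b. f (inv ax b)"] assms unfolding * ** by auto
qed

definition ft_factor_vec :: "complex ^ 'n \<Rightarrow> complex" where
  "ft_factor_vec z = (\<Prod>i\<in>UNIV. ft_factor (z $ i))"

lemma gaussian_eq_prod: "gaussian z x = (\<Prod>i\<in>UNIV. gaussian_1d (z $ i) (x $ i))"
  by (simp add: gaussian_def gaussian_1d_def)

lemma gaussian_fourier_char_prod:
  "gaussian z x * exp (- 2 * complex_of_real pi * \<i> * complex_of_real (x \<bullet> \<xi>))
    = (\<Prod>i\<in>UNIV. gaussian_1d (z $ i) (x $ i) * fourier_char (\<xi> $ i) (x $ i))"
  by (simp only: gaussian_eq_prod prod.distrib inner_vec_def inner_real_def of_real_sum
      sum_distrib_left exp_sum[OF finite])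

lemma fourier_transform_gaussian:
  assumes "\<And>i. Im (z $ i) > 0"
  shows "fourier_transform (gaussian z) \<xi> = ft_factor_vec z * gaussian (\<chi> i. - 1 / z $ i) \<xi>"
proof -
  have "integrable lborel (\<lambda>x. gaussian_1d (z $ i) x * fourier_char (\<xi> $ i) x)" for i
    using integrable_gaussian_1d_moment[OF assms, of i "\<xi> $ i" 0] by simp
  then have "fourier_transform (gaussian z) \<xi>
      = (\<Prod>i\<in>UNIV. (LINT x|lborel. gaussian_1d (z $ i) x * fourier_char (\<xi> $ i) x))"
    unfolding fourier_transform_def gaussian_fourier_char_prod by (rule integral_lborel_vec_prod)
  also have "\<dots> = ft_factor_vec z * gaussian (\<chi> i. - 1 / z $ i) \<xi>"
    by (simp only: gaussian_1d_fourier[OF assms] ft_factor_vec_def prod.distrib gaussian_eq_prod vec_lambda_beta)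
  finally show ?thesis .
qed

lemma integrable_gaussian:
  fixes z :: "complex ^ 'n"
  assumes "\<And>i. Im (z $ i) > 0"
  shows "integrable lborel (gaussian z)"
proof -
  have "integrable lborel (gaussian_1d (z $ i))" for i
    using integrable_gaussian_1d_moment[OF assms, of i 0 0] by simp
  from integral_lborel_vec_prod(1)[OF this] show ?thesis
    by (simp add: gaussian_eq_prod[abs_def])
qed

section \<open>A closed cycle of Moebius transformations\<close>

lemma Im_neg_inverse_pos: "Im z > 0 \<Longrightarrow> Im (- 1 / z) > 0"
  by (auto simp: Im_divide intro!: divide_pos_pos add_nonneg_pos)

lemma neg_inverse_eq:
  fixes a b c :: "'a::field"
  assumes "a * b = - c" "b \<noteq> 0" "c \<noteq> 0"
  shows "- 1 / b = a / c"
proof -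
  have "c = - (a * b)" using assms(1) by simp
  then show ?thesis using assms(2,3) by (auto simp: divide_simps)
qed

lemma eventually_ne_of_bounded:
  fixes f g :: "nat \<Rightarrow> complex"
  assumes "filterlim f at_infinity sequentially" "g \<longlonglongrightarrow> L"
  shows "\<forall>\<^sub>F m in sequentially. f m \<noteq> g m"
proof -
  have "filterlim (\<lambda>m. - g m + f m) at_infinity sequentially"
    by (rule tendsto_add_filterlim_at_infinity[OF tendsto_minus[OF assms(2)] assms(1)])
  then have "\<forall>\<^sub>F m in sequentially. - g m + f m \<noteq> 0"
    by (rule filterlim_at_infinity_imp_eventually_ne)
  then show ?thesis by eventually_elim auto
qed

lemma filterlim_affine:
  fixes a c :: complex
  assumes "c \<noteq> 0"
  shows "filterlim (\<lambda>m::nat. a + c * of_nat m) at_infinity sequentially"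
  by (intro tendsto_add_filterlim_at_infinity[OF tendsto_const]
      tendsto_mult_filterlim_at_infinity[OF tendsto_const assms] tendsto_of_nat)

text \<open>Writing \<open>L\<^sub>y\<close> for \<open>z \<mapsto> -1 / (-1 / z + y)\<close>, the points below trace the relation
  \<open>T\<^sub>2 \<circ> L\<^sub>y \<circ> T\<^sub>-\<^sub>b \<circ> L\<^sub>X \<circ> T\<^sub>b \<circ> L\<^sub>-\<^sub>y \<circ> T\<^sub>-\<^sub>2 = L\<^sub>X\<^sub>'\<close> with \<open>b = 2 / u\<close>, \<open>X' = X / u\<^sup>2\<close> and translations
  \<open>T\<^sub>a\<close> by \<open>a\<close>.  Here \<open>L\<^sub>X\<close> is applied to \<open>z3\<close>, and \<open>z5\<close> is the argument of \<open>L\<^sub>y\<close>.\<close>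

locale mobius_cycle =
  fixes u y :: real and z :: complex
  assumes u: "u \<noteq> 0" "u = 1 - 2 * y" and z: "Im z > 0"
begin

text \<open>The points \<open>q\<close> are images of the \<open>z\<close> under -1/z. There a lower
  triangular step is merely a translation, and the differences T_a g - g will be formed between
  these points and their translates.\<close>

definition "q1 = - 1 / (z - 2)"
definition "z3 = - 1 / (q1 - y) + of_real (2 / u)"
definition "q3 = - 1 / z3"
definition "z5 X = - 1 / (q3 + of_real X) - of_real (2 / u)"
definition "q5 X = - 1 / z5 X"

lemma Im_pos [simp]: "Im q1 > 0" "Im z3 > 0" "Im q3 > 0" "Im (z5 X) > 0" "Im (q5 X) > 0"
  "Im (- 1 / z) > 0" "Im (- 1 / (q1 - y)) > 0" "Im (- 1 / (q3 + of_real X)) > 0"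
  "Im (- 1 / (q5 X + y)) > 0" "Im (- 1 / (- 1 / z + of_real X)) > 0"
proof -
  show q1: "Im q1 > 0" unfolding q1_def using z by (intro Im_neg_inverse_pos) simp
  then show z2: "Im (- 1 / (q1 - y)) > 0" by (intro Im_neg_inverse_pos) simp
  then show "Im z3 > 0" unfolding z3_def by (simp only: plus_complex.sel Im_complex_of_real)
  then show q3: "Im q3 > 0" unfolding q3_def by (rule Im_neg_inverse_pos)
  then show z4: "Im (- 1 / (q3 + of_real X)) > 0" for X by (intro Im_neg_inverse_pos) simp
  then show "Im (z5 X) > 0" for X unfolding z5_def by (simp only: minus_complex.sel Im_complex_of_real diff_0_right)
  then show q5: "Im (q5 X) > 0" for X unfolding q5_def by (rule Im_neg_inverse_pos)
  then show "Im (- 1 / (q5 X + y)) > 0" for X by (intro Im_neg_inverse_pos) simp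
  show J: "Im (- 1 / z) > 0" using z by (rule Im_neg_inverse_pos)
  then show "Im (- 1 / (- 1 / z + of_real X)) > 0" for X by (intro Im_neg_inverse_pos) simp
qed

lemma Im_shift: "Im (z - 2) > 0" "Im (q1 - y) > 0" "Im (q3 + of_real X) > 0" "Im (q5 X + y) > 0"
  "Im (- 1 / z + of_real X) > 0"
  using z Im_pos(6) by simp_all

lemma nonzero: "z \<noteq> 0" "z - 2 \<noteq> 0" "q1 - y \<noteq> 0" "z3 \<noteq> 0" "q3 + of_real X \<noteq> 0" "z5 X \<noteq> 0"
  "q5 X + y \<noteq> 0" "- 1 / z + of_real X \<noteq> 0"
proof -
  have ne: "w \<noteq> 0" if "Im w > 0" for w using that by auto
  show "z \<noteq> 0" "z - 2 \<noteq> 0" using z by (intro ne; simp)+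
  show "q1 - y \<noteq> 0" by (intro ne) (simp only: minus_complex.sel Im_complex_of_real Im_pos diff_0_right)
  show "z3 \<noteq> 0" "z5 X \<noteq> 0" by (intro ne Im_pos)+
  show "q3 + of_real X \<noteq> 0" "q5 X + y \<noteq> 0" "- 1 / z + of_real X \<noteq> 0"
    by (intro ne; simp only: plus_complex.sel Im_complex_of_real Im_pos add_0_right)+
qed

text \<open>Denominators: the first lower triangular step sends z - 2 to (z - 2)/d, the second sends
  \<open>z3\<close> to z3 / e X. Expressing everything through them avoids nested fractions.\<close>

definition "d = of_real u + of_real y * z"
definition "e X = 1 - of_real X * z3"

lemma of_real_u: "complex_of_real u = 1 - 2 * of_real y"
  using u(2) by simp

lemma prod1: "(z - 2) * (q1 - y) = - d"
proof -
  have "q1 * (z - 2) = - 1" unfolding q1_def using nonzero(2) by simp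
  moreover have "(z - 2) * (q1 - y) = q1 * (z - 2) - of_real y * (z - 2)" by algebra
  ultimately have "(z - 2) * (q1 - y) = - 1 - of_real y * (z - 2)" by simp
  then show ?thesis by (simp add: d_def of_real_u algebra_simps)
qed

lemma d_nz: "d \<noteq> 0"
  using prod1 nonzero(2,3) by auto

text \<open>The first three maps compose to the matrix with rows (1/u, 0) and (y, u); the
  translation by 2/u removes the upper right entry. Conjugating a lower triangular unipotent with it
  divides the entry X by u^2.\<close>

lemma z3_eq: "of_real u * d * z3 = z"
proof -
  have "- 1 / (q1 - y) = (z - 2) / d"
    by (rule neg_inverse_eq[OF prod1 nonzero(3) d_nz])
  then have "of_real u * d * z3 = of_real u * (z - 2) + 2 * d"
    using d_nz u(1) by (simp add: z3_def distrib_left)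
  also have "\<dots> = z" by (simp add: d_def of_real_u algebra_simps)
  finally show ?thesis .
qed

lemma prod3: "z3 * (q3 + of_real X) = - e X"
proof -
  have "z3 * q3 = - 1" unfolding q3_def using nonzero(4) by simp
  then show ?thesis by (simp add: e_def distrib_left)
qed

lemma e_nz: "e X \<noteq> 0"
  using prod3[of X] nonzero(4) nonzero(5)[of X] by auto

lemma prod5: "z5 X * (q5 X + y) = - (1 - of_real y * z5 X)"
proof -
  have "z5 X * q5 X = - 1" unfolding q5_def using nonzero(6) by simp
  then show ?thesis by (simp add: distrib_left)
qed

lemma z5_eq: "of_real u * (d * e X * z5 X) = z - 2 * d * e X"
proof -
  have "- 1 / (q3 + of_real X) = z3 / e X"
    by (rule neg_inverse_eq[OF prod3 nonzero(5) e_nz])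
  then have "of_real u * (d * e X * z5 X) = of_real u * d * z3 - 2 * d * e X"
    using e_nz[of X] u(1) by (simp add: z5_def right_diff_distrib)
  then show ?thesis by (simp add: z3_eq)
qed

lemma ude_eq: "of_real u * (d * e X) = of_real u * d - of_real X * z"
  using z3_eq by (simp add: e_def algebra_simps)

text \<open>Cocycle relation: the denominators of the three lower triangular steps multiply to the
  denominator of the single step with entry X/u^2. It serves both for closing the cycle and for the
  scalar factors.\<close>

lemma de_eq: "d * e X * (1 - of_real y * z5 X) = 1 - of_real (X / u\<^sup>2) * z"
proof -
  let ?u = "complex_of_real u"
  have y: "of_real y = (1 - ?u) / 2" using u(2) by simp
  have "?u * ?u * (d * e X * (1 - of_real y * z5 X))
      = ?u * (?u * (d * e X)) - of_real y * ?u * (?u * (d * e X * z5 X))" by algebra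
  also have "\<dots> = ?u * (?u * (d * e X)) - of_real y * (?u * z - 2 * (?u * (d * e X)))"
    unfolding z5_eq by algebra
  also have "\<dots> = ?u * (?u * d - of_real X * z) - of_real y * (?u * z - 2 * (?u * d - of_real X * z))"
    unfolding ude_eq ..
  also have "\<dots> = ?u * ?u - of_real X * z"
    unfolding d_def y by (simp add: field_simps)
  also have "\<dots> = ?u * ?u * (1 - of_real (X / u\<^sup>2) * z)"
    using u(1) by (simp add: power2_eq_square field_simps)
  finally have "?u * ?u * (d * e X * (1 - of_real y * z5 X)) = ?u * ?u * (1 - of_real (X / u\<^sup>2) * z)" .
  then show ?thesis using u(1) by simp
qed

lemma inverse_shift: "z * (- 1 / z + of_real r) = - (1 - of_real r * z)"
proof -
  have "z * (- 1 / z + of_real r) = z * (- 1 / z) + z * of_real r" by (rule distrib_left)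
  also have "z * (- 1 / z) = - 1" using nonzero(1) by simp
  finally show ?thesis by (simp add: mult.commute)
qed

lemma cycle_closes: "- 1 / (q5 X + y) + 2 = - 1 / (- 1 / z + of_real (X / u\<^sup>2))"
proof -
  let ?u = "complex_of_real u"
  define t where "t = 1 - of_real (X / u\<^sup>2) * z"
  define v where "v = 1 - of_real y * z5 X"
  have y: "of_real y = (1 - ?u) / 2" using u(2) by simp
  have t: "d * e X * v = t" using de_eq by (simp add: t_def v_def)
  have v_nz: "v \<noteq> 0" using prod5[of X] nonzero(6)[of X] nonzero(7)[of X] by (auto simp: v_def)
  then have t_nz: "t \<noteq> 0" using t d_nz e_nz[of X] by auto
  have "- 1 / (q5 X + y) = z5 X / v"
    by (rule neg_inverse_eq[OF _ nonzero(7) v_nz]) (simp add: v_def prod5)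
  moreover have "- 1 / (- 1 / z + of_real (X / u\<^sup>2)) = z / t"
  proof -
    have "z * (- 1 / z + of_real (X / u\<^sup>2)) = - t"
      unfolding t_def by (rule inverse_shift)
    then show ?thesis by (rule neg_inverse_eq[OF _ nonzero(8) t_nz])
  qed
  moreover have "z5 X / v + 2 = z / t"
  proof -
    have ut: "?u * t = d * e X - of_real y * z"
    proof -
      have "?u * t = ?u * (d * e X) - of_real y * (?u * (d * e X * z5 X))"
        unfolding t[symmetric] v_def by algebra
      also have "\<dots> = (?u + 2 * of_real y) * (d * e X) - of_real y * z"
        unfolding z5_eq by algebra
      also have "?u + 2 * of_real y = 1" using u(2) by simp
      finally show ?thesis by simp
    qed
    have "?u * t * (z5 X + 2 * v) = v * (?u * (d * e X * z5 X)) + 2 * v * ?u * t"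
      unfolding t[symmetric] by algebra
    also have "\<dots> = v * (z - 2 * (d * e X) + 2 * (?u * t))"
      unfolding z5_eq by algebra
    also have "\<dots> = v * (z - 2 * (d * e X) + 2 * (d * e X - of_real y * z))"
      unfolding ut ..
    also have "\<dots> = ?u * (v * z)"
      unfolding y by (simp add: field_simps)
    finally have "t * (z5 X + 2 * v) = v * z" using u(1) by simp
    then show ?thesis using v_nz t_nz by (simp add: field_simps)
  qed
  ultimately show ?thesis by simp
qed

text \<open>The scalars that the Fourier transform produces along the two sides of the relation.
  Each lower triangular step applies it twice, hence six factors against two.\<close>

definition "cycle_factor X = ft_factor (z - 2) * ft_factor (q1 - y) * ft_factor z3 * ft_factor (q3 + of_real X) * ft_factor (z5 X) * ft_factor (q5 X + y)"
definition "direct_factor X = ft_factor z * ft_factor (- 1 / z + of_real (X / u\<^sup>2))"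

lemma direct_factor_nz: "direct_factor X \<noteq> 0"
  unfolding direct_factor_def mult_eq_0_iff using ft_factor_nonzero[OF z] ft_factor_nonzero[OF Im_shift(5)] by blast

text \<open>Each factor squares to 1/(- \<i> w), so the squares are reciprocals of products of
  denominators, which \<open>de_eq\<close> compares. The sign of (- \<i>)^6 cancels the three signs
  in \<open>prod1\<close>, \<open>prod3\<close> and \<open>prod5\<close>.\<close>

lemma factors_same_square: "(cycle_factor X)\<^sup>2 = (direct_factor X)\<^sup>2"
proof -
  have "(cycle_factor X)\<^sup>2 = 1 / ((- \<i>) ^ 6 * (((z - 2) * (q1 - y)) * (z3 * (q3 + of_real X)) * (z5 X * (q5 X + y))))"
  proof -
    have "1 / (k * a1) * (1 / (k * a2)) * (1 / (k * a3)) * (1 / (k * a4)) * (1 / (k * a5)) * (1 / (k * a6))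
        = 1 / (k ^ 6 * ((a1 * a2) * (a3 * a4) * (a5 * a6)))" for k a1 a2 a3 a4 a5 a6 :: complex
      by (simp add: eval_nat_numeral mult_ac)
    then show ?thesis
      by (simp only: cycle_factor_def power_mult_distrib ft_factor_square Im_shift Im_pos)
  qed
  also have "\<dots> = 1 / (d * e X * (1 - of_real y * z5 X))"
  proof -
    have "(- \<i>) ^ 6 = (- 1 :: complex)" by (simp add: eval_nat_numeral)
    moreover have "- 1 * (- a1 * - a2 * - a3) = a1 * a2 * a3" for a1 a2 a3 :: complex by simp
    ultimately show ?thesis by (simp only: prod1 prod3 prod5)
  qed
  also have "\<dots> = 1 / (1 - of_real (X / u\<^sup>2) * z)" unfolding de_eq ..
  also have "\<dots> = (direct_factor X)\<^sup>2"
  proof -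
    have "(direct_factor X)\<^sup>2 = 1 / ((- \<i>)\<^sup>2 * (z * (- 1 / z + of_real (X / u\<^sup>2))))"
    proof -
      have "1 / (k * a1) * (1 / (k * a2)) = 1 / (k\<^sup>2 * (a1 * a2))" for k a1 a2 :: complex
        by (simp add: power2_eq_square mult_ac)
      then show ?thesis
        by (simp only: direct_factor_def power_mult_distrib ft_factor_square Im_shift z)
    qed
    also have "z * (- 1 / z + of_real (X / u\<^sup>2)) = - (1 - of_real (X / u\<^sup>2) * z)"
      by (rule inverse_shift)
    finally show ?thesis by simp
  qed
  finally show ?thesis .
qed

text \<open>For X = 0 the middle step is trivial and the cycle retraces its path, so the factors
  cancel in pairs.\<close>

lemma factors_at_zero: "cycle_factor 0 = 1" "direct_factor 0 = 1"
proof -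
  have z5: "z5 0 = - 1 / (q1 - y)" using nonzero(4) by (simp add: z5_def q3_def z3_def)
  have q5: "q5 0 = q1 - y" unfolding q5_def z5 using nonzero(3) by simp
  have "cycle_factor 0 = (ft_factor (z - 2) * ft_factor (- 1 / (z - 2))) * (ft_factor (q1 - y) * ft_factor (- 1 / (q1 - y)))
      * (ft_factor z3 * ft_factor (- 1 / z3))"
    by (simp add: cycle_factor_def q5 z5 q1_def[symmetric] q3_def[symmetric])
      (simp add: q1_def q3_def)
  also have "\<dots> = 1" by (simp only: ft_factor_involution[OF Im_shift(1)] ft_factor_involution[OF Im_shift(2)]
        ft_factor_involution[OF Im_pos(2)] mult_1)
  finally show "cycle_factor 0 = 1" .
  show "direct_factor 0 = 1" using ft_factor_involution[OF z] by (simp add: direct_factor_def)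
qed

text \<open>Both sides have the same square, so their quotient is a sign depending continuously on \<open>X\<close>.\<close>

lemma factors_agree: "cycle_factor X = direct_factor X"
proof -
  have sq: "(cycle_factor X / direct_factor X)\<^sup>2 = 1" for X
    using factors_same_square direct_factor_nz by (simp add: power_divide)
  have "(\<lambda>X. cycle_factor X / direct_factor X) constant_on UNIV"
  proof (rule continuous_finite_range_constant)
    have "cycle_factor X / direct_factor X \<in> {1, -1}" for X using sq[of X] by (simp add: power2_eq_1_iff)
    then have "range (\<lambda>X. cycle_factor X / direct_factor X) \<subseteq> {1, -1}" by blast
    then show "finite (range (\<lambda>X. cycle_factor X / direct_factor X))"
      by (rule finite_subset) simp
    have ft_factor: "continuous_on UNIV (\<lambda>X. ft_factor (f X))"
      if "continuous_on UNIV f" "\<And>X. Im (f X) > 0" for f :: "real \<Rightarrow> complex"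
      by (rule continuous_on_compose2[OF holomorphic_on_imp_continuous_on[OF ft_factor_holomorphic]])
        (use that in auto)
    have "continuous_on UNIV z5"
      unfolding z5_def by (intro continuous_intros) (use nonzero in auto)
    moreover from this have "continuous_on UNIV q5"
      unfolding q5_def by (intro continuous_intros) (use nonzero in auto)
    ultimately have "continuous_on UNIV cycle_factor"
      unfolding cycle_factor_def
      by (intro continuous_on_mult continuous_on_const ft_factor continuous_on_add continuous_on_of_real
          continuous_on_id Im_shift Im_pos)
    moreover have "continuous_on UNIV direct_factor"
      unfolding direct_factor_def using u(1)
      by (intro continuous_on_mult continuous_on_const ft_factor continuous_on_add continuous_on_of_real
          continuous_on_divide continuous_on_id Im_shift) simp
    ultimately show "continuous_on UNIV (\<lambda>X. cycle_factor X / direct_factor X)"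
      by (intro continuous_intros) (use direct_factor_nz in auto)
  qed simp
  then have "cycle_factor X / direct_factor X = cycle_factor 0 / direct_factor 0" by (auto simp: constant_on_def)
  then show ?thesis using direct_factor_nz[of X] by (simp add: factors_at_zero)
qed

section \<open>Separating one parameter from the others as X grows\<close>

lemma eventually_avoids:
  assumes "finite Z"
  shows "\<forall>\<^sub>F m in sequentially. q3 + complex_of_real (2 * real m) \<notin> Z"
proof -
  have "filterlim (\<lambda>m. q3 + complex_of_real (2 * real m)) at_infinity sequentially"
    using filterlim_affine[of 2 q3] by simp
  then have "\<forall>\<^sub>F m in sequentially. q3 + complex_of_real (2 * real m) \<noteq> w" for w
    by (rule eventually_ne_of_bounded[OF _ tendsto_const])
  then have "\<forall>\<^sub>F m in sequentially. \<forall>w\<in>Z. q3 + complex_of_real (2 * real m) \<noteq> w"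
    using assms by (simp add: eventually_ball_finite)
  then show ?thesis by eventually_elim blast
qed

text \<open>The singled-out point goes to infinity with speed 2 in \<open>m\<close>. The others are
  constant or converge, except -1/z + 2m/u^2, whose speed differs because u^2 \<noteq> 1.\<close>

lemma eventually_unique:
  assumes "u\<^sup>2 \<noteq> 1"
  shows "\<forall>\<^sub>F m in sequentially. q3 + of_real (2 * real m) \<notin>
    {q1 - y, q1, q3, q5 (2 * real m) + y, q5 (2 * real m), - 1 / z + of_real (2 * real m / u\<^sup>2), - 1 / z,
     z, z - 2, - 1 / (q1 - y), z3, - 1 / (q3 + of_real (2 * real m)), z5 (2 * real m),
     - 1 / (q5 (2 * real m) + y), - 1 / (- 1 / z + of_real (2 * real m / u\<^sup>2))}"
proof -
  let ?f = "\<lambda>m::nat. q3 + complex_of_real (2 * real m)"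
  let ?g = "\<lambda>m::nat. - 1 / z + complex_of_real (2 * real m / u\<^sup>2)"
  have f: "filterlim ?f at_infinity sequentially"
    using filterlim_affine[of 2 q3] by simp
  have g: "filterlim ?g at_infinity sequentially"
    using filterlim_affine[of "of_real (2 / u\<^sup>2)" "- 1 / z"] u(1) by simp
  have z4: "(\<lambda>m. - 1 / ?f m) \<longlonglongrightarrow> 0"
    by (rule tendsto_divide_0[OF tendsto_const f])
  have z5: "(\<lambda>m. z5 (2 * real m)) \<longlonglongrightarrow> 0 - of_real (2 / u)"
    unfolding z5_def by (intro tendsto_diff z4 tendsto_const)
  have q5: "(\<lambda>m. q5 (2 * real m)) \<longlonglongrightarrow> - 1 / (0 - of_real (2 / u))"
    unfolding q5_def by (intro tendsto_divide z5 tendsto_const) (simp add: u(1) del: of_real_divide)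
  have q5y: "(\<lambda>m. q5 (2 * real m) + y) \<longlonglongrightarrow> - 1 / (0 - of_real (2 / u)) + of_real y"
    by (intro tendsto_add q5 tendsto_const)
  \<comment> \<open>The limit is u/2 + y = 1/2; being nonzero, it allows the passage to the limit in
    -1/(q5 + y).\<close>
  have "- 1 / (0 - complex_of_real (2 / u)) + of_real y = 1 / 2"
    using u(1) by (simp add: of_real_u field_simps)
  note q5y' = q5y[unfolded this]
  have z6: "(\<lambda>m. - 1 / (q5 (2 * real m) + y)) \<longlonglongrightarrow> - 1 / (1 / 2)"
    by (rule tendsto_divide[OF tendsto_const q5y']) simp
  have z7: "(\<lambda>m. - 1 / ?g m) \<longlonglongrightarrow> 0"
    by (rule tendsto_divide_0[OF tendsto_const g])
  have "\<forall>\<^sub>F m in sequentially. q3 + 1 / z + of_real (2 - 2 / u\<^sup>2) * of_nat m \<noteq> 0"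
  proof (rule filterlim_at_infinity_imp_eventually_ne[OF filterlim_affine])
    show "complex_of_real (2 - 2 / u\<^sup>2) \<noteq> 0"
      unfolding of_real_eq_0_iff using assms u(1) by (simp add: field_simps)
  qed
  then have gf: "\<forall>\<^sub>F m in sequentially. ?f m \<noteq> ?g m"
    by eventually_elim (auto simp: algebra_simps)
  note ev = eventually_ne_of_bounded[OF f]
  show ?thesis
    using ev[OF tendsto_const[of "q1 - y"]] ev[OF tendsto_const[of q1]] ev[OF tendsto_const[of q3]]
      ev[OF q5y] ev[OF q5] gf ev[OF tendsto_const[of "- 1 / z"]] ev[OF tendsto_const[of z]]
      ev[OF tendsto_const[of "z - 2"]] ev[OF tendsto_const[of "- 1 / (q1 - y)"]]
      ev[OF tendsto_const[of z3]] ev[OF z4] ev[OF z5] ev[OF z6] ev[OF z7]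
    by eventually_elim blast
qed

end

section \<open>Eigenfunctions in the span of the Gaussians\<close>

lemma gaussian_1d_add: "gaussian_1d z (sqrt (x\<^sup>2 + y\<^sup>2)) = gaussian_1d z x * gaussian_1d z y"
proof -
  have "complex_of_real (x\<^sup>2 + y\<^sup>2) = (complex_of_real x)\<^sup>2 + (complex_of_real y)\<^sup>2" by simp
  then show ?thesis
    by (simp add: gaussian_1d_def distrib_left flip: exp_add of_real_power)
qed

lemma gaussian_1d_0: "gaussian_1d z 0 = 1"
  by (simp add: gaussian_1d_def)

lemma gaussian_1d_inj:
  assumes "\<And>x. gaussian_1d z x = gaussian_1d w x"
  shows "z = w"
proof (rule ccontr)
  assume "z \<noteq> w"
  define d where "d = z - w"
  \<comment> \<open>At x^2 = s the two exponents differ by less than pi in absolute value, too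
    little for a nonzero multiple of 2 pi \<i>.\<close>
  define s where "s = 1 / (1 + norm d)"
  have s: "s > 0" "norm d * s < 1" by (simp_all add: s_def add_pos_nonneg divide_less_eq)
  have "exp (complex_of_real pi * \<i> * z * of_real s) = exp (complex_of_real pi * \<i> * w * of_real s)"
    using assms[of "sqrt s"] s by (simp add: gaussian_1d_def flip: of_real_power)
  then have "exp (complex_of_real pi * \<i> * d * of_real s) = 1"
    by (simp add: d_def algebra_simps exp_diff)
  then obtain k :: int where k: "Re (complex_of_real pi * \<i> * d * of_real s) = 0"
    "Im (complex_of_real pi * \<i> * d * of_real s) = of_int (2 * k) * pi"
    unfolding exp_eq_1 by blast
  then have "Re d * s = 2 * k" "Im d = 0" using s by auto
  moreover have "\<bar>Re d\<bar> * s < 1"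
    using s by (meson abs_Re_le_cmod le_less_trans less_imp_le mult_right_mono)
  then have "\<bar>Re d * s\<bar> < 1" using s by (simp add: abs_mult)
  ultimately have "\<bar>real_of_int (2 * k)\<bar> < 1" by simp
  then have "k = 0" by linarith
  then have "d = 0" using \<open>Re d * s = 2 * k\<close> \<open>Im d = 0\<close> s by (simp add: complex_eq_iff)
  then show False using \<open>z \<noteq> w\<close> by (simp add: d_def)
qed

lemma gaussian_inj: "inj gaussian"
proof (rule injI)
  fix z w :: "complex ^ 'n" assume eq: "gaussian z = gaussian w"
  have "gaussian_1d (z $ i) t = gaussian_1d (w $ i) t" for i t
  proof -
    have "gaussian v (axis i t) = gaussian_1d (v $ i) t" for v :: "complex ^ 'n"
      unfolding gaussian_eq_prod
      by (subst prod.remove[of _ i]) (auto simp: axis_def gaussian_1d_0 intro!: prod.neutral)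
    then show ?thesis using eq by metis
  qed
  then show "z = w" by (auto simp: vec_eq_iff intro: gaussian_1d_inj)
qed

lemma sum_fun_apply: "(\<Sum>a\<in>A. f a) x = (\<Sum>a\<in>A. f a x)" for f :: "'b \<Rightarrow> 'a \<Rightarrow> 'c::comm_monoid_add"
  by (induction A rule: infinite_finite_induct) auto

text \<open>Under \<open>(x, y) \<mapsto> sqrt (x\<^sup>2 + y\<^sup>2)\<close> (taken componentwise), Gaussians are multiplicative.\<close>

lemma gaussian_not_in_span:
  fixes z :: "complex ^ 'n"
  assumes "z \<notin> P"
  shows "gaussian z \<notin> cfun.span (gaussian ` P)"
proof
  assume "gaussian z \<in> cfun.span (gaussian ` P)"
  then obtain t r where t: "finite t" "t \<subseteq> gaussian ` P"
    and z: "gaussian z = (\<Sum>a\<in>t. (\<lambda>x. r a * a x))"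
    unfolding cfun.span_explicit by blast
  have nt: "gaussian z \<notin> t" using t(2) assms gaussian_inj by (auto dest: injD)
  define c where "c a = (if a = gaussian z then -1 else r a)" for a
  have "c (gaussian z) = 0"
  proof (rule multiplicative_functions_independent[of "insert (gaussian z) t" "\<lambda>a. a"
        "\<lambda>x y. \<chi> i. sqrt ((x $ i)\<^sup>2 + (y $ i)\<^sup>2)" c])
    show "a (\<chi> i. sqrt ((x $ i)\<^sup>2 + (y $ i)\<^sup>2)) = a x * a y" if "a \<in> insert (gaussian z) t" for a x y
      using that t(2) by (auto simp: gaussian_eq_prod gaussian_1d_add prod.distrib)
    show "\<exists>x. a x \<noteq> 0" if "a \<in> insert (gaussian z) t" for a
      using that t(2) by (auto simp: gaussian_eq_prod gaussian_1d_def)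
    show "(\<Sum>a\<in>insert (gaussian z) t. c a * a x) = 0" for x
    proof -
      have "(\<Sum>a\<in>t. c a * a x) = (\<Sum>a\<in>t. r a * a x)"
        using nt by (intro sum.cong) (auto simp: c_def)
      also have "\<dots> = gaussian z x" using fun_cong[OF z, of x] by (simp add: sum_fun_apply)
      finally show ?thesis using t(1) nt by (simp add: c_def)
    qed
  qed (use t in auto)
  then show False by (simp add: c_def)
qed

section \<open>The Fourier transform on the span of the Gaussians\<close>

lemma cfun_span_lam:
  fixes f g :: "'a \<Rightarrow> complex"
  assumes "f \<in> cfun.span S" "g \<in> cfun.span S"
  shows "(\<lambda>x. f x + g x) \<in> cfun.span S" "(\<lambda>x. f x - g x) \<in> cfun.span S"
  using cfun.span_add[OF assms] cfun.span_diff[OF assms] by (simp_all add: plus_fun_def fun_diff_def)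

lemma cfun_span_lam_scale: "f \<in> cfun.span S \<Longrightarrow> (\<lambda>x. c * f x) \<in> cfun.span S"
  by (rule cfun.span_scale)

lemma gaussian_span_base: "(\<And>i. Im (z $ i) > 0) \<Longrightarrow> gaussian z \<in> gaussian_span"
  unfolding gaussian_span_def by (intro cfun.span_base) blast

lemmas gaussian_span_lam = cfun_span_lam[of _ "{gaussian z | z. \<forall>i. Im (z $ i) > 0}", folded gaussian_span_def]
  cfun_span_lam_scale[of _ "{gaussian z | z. \<forall>i. Im (z $ i) > 0}", folded gaussian_span_def]

text \<open>The induction step carries both memberships because they provide the integrability on
  which linearity of the Fourier integral rests.\<close>

lemma gaussian_span_induct [consumes 1, case_names gauss lin zero]:
  assumes "f \<in> gaussian_span"
    and "\<And>z. (\<And>i. Im (z $ i) > 0) \<Longrightarrow> P (gaussian z)"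
    and "\<And>f g c. f \<in> gaussian_span \<Longrightarrow> g \<in> gaussian_span \<Longrightarrow> P f \<Longrightarrow> P g \<Longrightarrow> P (\<lambda>x. c * f x + g x)"
    and "P (\<lambda>x. 0)"
  shows "P f"
proof -
  have "f \<in> gaussian_span \<and> P f"
    using assms(1) unfolding gaussian_span_def
  proof (induction rule: cfun.span_induct_alt)
    case base
    then show ?case using assms(4) cfun.span_zero by (simp add: zero_fun_def)
  next
    case (step c f g)
    then obtain z where z: "f = gaussian z" "\<And>i. Im (z $ i) > 0" by blast
    have f: "f \<in> gaussian_span" "P f"
      unfolding z(1) using z(2) by (auto intro: gaussian_span_base assms(2))
    have "(\<lambda>x. c * f x + g x) \<in> gaussian_span"
      by (intro gaussian_span_lam f) (use step.IH in \<open>simp add: gaussian_span_def\<close>)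
    then show ?case
      using assms(3)[OF f(1) _ f(2), of g c] step.IH by (simp add: gaussian_span_def plus_fun_def)
  qed
  then show ?thesis ..
qed

lemma integrable_gaussian_span: "f \<in> gaussian_span \<Longrightarrow> integrable lborel f"
proof (induction f rule: gaussian_span_induct)
  case (lin f g c)
  then show ?case by (intro Bochner_Integration.integrable_add integrable_mult_right)
qed (auto intro: integrable_gaussian)

lemma integrable_gaussian_span_fourier_char:
  assumes "f \<in> gaussian_span"
  shows "integrable lborel (\<lambda>x. f x * exp (- 2 * complex_of_real pi * \<i> * complex_of_real (x \<bullet> \<xi>)))"
proof (rule Bochner_Integration.integrable_bound[OF integrable_gaussian_span[OF assms]])
  have "f \<in> borel_measurable borel"
    using integrable_gaussian_span[OF assms] by (simp add: borel_measurable_integrable)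
  moreover have "(\<lambda>x. exp (- 2 * complex_of_real pi * \<i> * complex_of_real (x \<bullet> \<xi>))) \<in> borel_measurable borel"
    by (intro borel_measurable_continuous_onI continuous_intros)
  ultimately show "(\<lambda>x. f x * exp (- 2 * complex_of_real pi * \<i> * complex_of_real (x \<bullet> \<xi>))) \<in> borel_measurable lborel"
    by simp
qed (auto simp: norm_mult norm_exp_eq_Re)

lemma fourier_transform_linear:
  fixes f g :: "real ^ 'n \<Rightarrow> complex"
  assumes "f \<in> gaussian_span" "g \<in> gaussian_span"
  shows "fourier_transform (\<lambda>x. c * f x + g x) = (\<lambda>\<xi>. c * fourier_transform f \<xi> + fourier_transform g \<xi>)"
proof
  fix \<xi>
  let ?e = "\<lambda>x::real^'n. exp (- 2 * complex_of_real pi * \<i> * complex_of_real (x \<bullet> \<xi>))"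
  have "(LINT x|lborel. c * (f x * ?e x) + g x * ?e x)
      = (LINT x|lborel. c * (f x * ?e x)) + (LINT x|lborel. g x * ?e x)"
    by (intro Bochner_Integration.integral_add integrable_mult_right integrable_gaussian_span_fourier_char assms)
  then show "fourier_transform (\<lambda>x. c * f x + g x) \<xi> = c * fourier_transform f \<xi> + fourier_transform g \<xi>"
    unfolding fourier_transform_def by (simp only: distrib_right mult.assoc integral_mult_right_zero)
qed

lemma fourier_transform_add:
  "f \<in> gaussian_span \<Longrightarrow> g \<in> gaussian_span \<Longrightarrow>
    fourier_transform (\<lambda>x. f x + g x) = (\<lambda>\<xi>. fourier_transform f \<xi> + fourier_transform g \<xi>)"
  using fourier_transform_linear[of f g 1] by simp

lemma fourier_transform_diff:
  "f \<in> gaussian_span \<Longrightarrow> g \<in> gaussian_span \<Longrightarrow>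
    fourier_transform (\<lambda>x. f x - g x) = (\<lambda>\<xi>. fourier_transform f \<xi> - fourier_transform g \<xi>)"
  using fourier_transform_linear[of g f "-1"] by (simp add: fun_eq_iff)

definition neg_inv :: "complex ^ 'n \<Rightarrow> complex ^ 'n" where
  "neg_inv z = (\<chi> i. - 1 / z $ i)"

lemma neg_inv_pos: "(\<And>i. Im (z $ i) > 0) \<Longrightarrow> Im (neg_inv z $ i) > 0"
  unfolding neg_inv_def vec_lambda_beta by (rule Im_neg_inverse_pos)

lemma neg_inv_neg_inv [simp]: "neg_inv (neg_inv z) = z"
  by (simp add: neg_inv_def vec_eq_iff)

lemma ft_factor_vec_neg_inv:
  assumes "\<And>i. Im (z $ i) > 0"
  shows "ft_factor_vec z * ft_factor_vec (neg_inv z) = 1"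
  unfolding ft_factor_vec_def neg_inv_def vec_lambda_beta prod.distrib[symmetric]
  using ft_factor_involution[OF assms] by (intro prod.neutral) blast

lemma ft_factor_vec_nonzero: "(\<And>i. Im (z $ i) > 0) \<Longrightarrow> ft_factor_vec z \<noteq> 0"
  using ft_factor_vec_neg_inv[of z] by auto

lemma fourier_transform_gaussian_vec:
  "(\<And>i. Im (z $ i) > 0) \<Longrightarrow> fourier_transform (gaussian z) = (\<lambda>\<xi>. ft_factor_vec z * gaussian (neg_inv z) \<xi>)"
  using fourier_transform_gaussian[of z] by (auto simp: neg_inv_def)

lemma fourier_transform_zero: "fourier_transform (\<lambda>x. 0) = (\<lambda>\<xi>. 0)"
  by (simp add: fourier_transform_def fun_eq_iff)

lemma zero_in_gaussian_span: "(\<lambda>x. 0) \<in> gaussian_span"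
  using cfun.span_zero unfolding gaussian_span_def by (simp add: zero_fun_def)

lemma fourier_transform_scale: "f \<in> gaussian_span \<Longrightarrow> fourier_transform (\<lambda>x. c * f x) = (\<lambda>\<xi>. c * fourier_transform f \<xi>)"
  using fourier_transform_linear[OF _ zero_in_gaussian_span, of f c] by (simp add: fun_eq_iff fourier_transform_zero)

text \<open>Inversion involves no reflection since Gaussians are even. Both claims share one
  induction: linearity of the outer transform requires the inner one to stay in the span.\<close>

lemma fourier_transform_in_gaussian_span: "f \<in> gaussian_span \<Longrightarrow> fourier_transform f \<in> gaussian_span"
  and fourier_transform_involution: "f \<in> gaussian_span \<Longrightarrow> fourier_transform (fourier_transform f) = f"
proof -
  have "fourier_transform f \<in> gaussian_span \<and> fourier_transform (fourier_transform f) = f"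
    if "f \<in> gaussian_span"
    using that
  proof (induction f rule: gaussian_span_induct)
    case (gauss z)
    have G: "gaussian (neg_inv z) \<in> gaussian_span"
      by (intro gaussian_span_base neg_inv_pos gauss)
    then have "(\<lambda>\<xi>. ft_factor_vec z * gaussian (neg_inv z) \<xi>) \<in> gaussian_span"
      by (rule gaussian_span_lam)
    moreover have "fourier_transform (\<lambda>\<xi>. ft_factor_vec z * gaussian (neg_inv z) \<xi>)
        = (\<lambda>\<xi>. ft_factor_vec z * (ft_factor_vec (neg_inv z) * gaussian (neg_inv (neg_inv z)) \<xi>))"
      by (simp only: fourier_transform_scale[OF G] fourier_transform_gaussian_vec[OF neg_inv_pos[OF gauss]])
    ultimately show ?case
      using ft_factor_vec_neg_inv[OF gauss] by (simp add: fourier_transform_gaussian_vec[OF gauss] flip: mult.assoc)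
  next
    case (lin f g c)
    then show ?case
      by (simp add: fourier_transform_linear gaussian_span_lam)
  qed (auto simp: fourier_transform_zero zero_in_gaussian_span)
  then show "f \<in> gaussian_span \<Longrightarrow> fourier_transform f \<in> gaussian_span"
    "f \<in> gaussian_span \<Longrightarrow> fourier_transform (fourier_transform f) = f" by auto
qed

text \<open>The transform h of \<open>c\<close> times the Gaussian of \<open>w\<close> is
  \<open>c * ft_factor_vec w\<close> times the Gaussian of \<open>neg_inv w\<close>. The step is T_a
  h - h, where \<open>p\<close> will be the translate of \<open>neg_inv w\<close>.\<close>

definition cycle_step :: "complex \<Rightarrow> complex ^ 'n \<Rightarrow> complex ^ 'n \<Rightarrow> real ^ 'n \<Rightarrow> complex" where
  "cycle_step c w p = (\<lambda>x. c * ft_factor_vec w * (gaussian p x - gaussian (neg_inv w) x))"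

lemma cycle_step_gaussian_span:
  assumes "\<And>i. Im (w $ i) > 0" "\<And>i. Im (p $ i) > 0"
  shows "cycle_step c w p \<in> gaussian_span"
  unfolding cycle_step_def
  by (intro gaussian_span_lam gaussian_span_base neg_inv_pos assms)

text \<open>A second transform gives output minus input of the lower triangular step from
  \<open>w\<close> to \<open>neg_inv p\<close>. The output carries the scalar with which the next
  step starts, so consecutive steps telescope up to translations.\<close>

lemma fourier_transform_cycle_step:
  assumes "\<And>i. Im (w $ i) > 0" "\<And>i. Im (p $ i) > 0"
  shows "fourier_transform (cycle_step c w p)
    = (\<lambda>\<xi>. c * ft_factor_vec w * ft_factor_vec p * gaussian (neg_inv p) \<xi> - c * gaussian w \<xi>)"
proof -
  have G: "gaussian p \<in> gaussian_span" "gaussian (neg_inv w) \<in> gaussian_span"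
    by (intro gaussian_span_base neg_inv_pos assms)+
  have "fourier_transform (cycle_step c w p) = (\<lambda>\<xi>. c * ft_factor_vec w * (ft_factor_vec p * gaussian (neg_inv p) \<xi>
      - ft_factor_vec (neg_inv w) * gaussian (neg_inv (neg_inv w)) \<xi>))"
    unfolding cycle_step_def
    by (simp only: fourier_transform_scale[OF gaussian_span_lam(2)[OF G]] fourier_transform_diff[OF G]
        fourier_transform_gaussian_vec[OF assms(2)] fourier_transform_gaussian_vec[OF neg_inv_pos[OF assms(1)]])
  also have "\<dots> = (\<lambda>\<xi>. c * ft_factor_vec w * ft_factor_vec p * gaussian (neg_inv p) \<xi>
      - c * (ft_factor_vec w * ft_factor_vec (neg_inv w)) * gaussian w \<xi>)"
    by (simp add: fun_eq_iff algebra_simps)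
  finally show ?thesis by (simp only: ft_factor_vec_neg_inv[OF assms(1)] mult_1_right)
qed

text \<open>If \<open>K\<close> and its Fourier transform both vanish on \<open>S\<close>, then so does the eigenfunction
  \<open>K + \<epsilon> * fourier_transform K\<close>.  Both vanish here because the Gaussians with parameters
  \<open>z\<close>, \<open>z1\<close>, \<open>neg_inv p1\<close>, \<open>z3\<close>, \<open>neg_inv p3\<close>, \<open>z5\<close>, \<open>neg_inv p5\<close>, \<open>neg_inv p0\<close> form a closed cycle.\<close>

lemma cycle_eigenfunction:
  fixes z z1 z3 z5 p1 p3 p5 p0 :: "complex ^ 'n"
  assumes pos: "\<forall>w\<in>{z, z1, z3, z5, p1, p3, p5, p0}. \<forall>i. Im (w $ i) > 0"
    and closed: "ft_factor_vec z1 * ft_factor_vec p1 * ft_factor_vec z3 * ft_factor_vec p3 * ft_factor_vec z5 * ft_factor_vec p5 = ft_factor_vec z * ft_factor_vec p0"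
    and eqs: "\<And>x. x \<in> S \<Longrightarrow> gaussian p1 x = gaussian (neg_inv z1) x"
      "\<And>x. x \<in> S \<Longrightarrow> gaussian p3 x = gaussian (neg_inv z3) x"
      "\<And>x. x \<in> S \<Longrightarrow> gaussian p5 x = gaussian (neg_inv z5) x"
      "\<And>x. x \<in> S \<Longrightarrow> gaussian p0 x = gaussian (neg_inv z) x"
      "\<And>x. x \<in> S \<Longrightarrow> gaussian z1 x = gaussian z x"
      "\<And>x. x \<in> S \<Longrightarrow> gaussian z3 x = gaussian (neg_inv p1) x"
      "\<And>x. x \<in> S \<Longrightarrow> gaussian z5 x = gaussian (neg_inv p3) x"
      "\<And>x. x \<in> S \<Longrightarrow> gaussian (neg_inv p0) x = gaussian (neg_inv p5) x"
    and eps: "\<epsilon> \<in> {1, -1}"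
    and uniq: "p3 $ j \<notin> (\<lambda>w. w $ j) ` {p1, neg_inv z1, neg_inv z3, p5, neg_inv z5, p0, neg_inv z, z, z1, neg_inv p1, z3, neg_inv p3, z5,
      neg_inv p5, neg_inv p0}"
  shows "\<exists>f\<in>gaussian_span. fourier_transform f = (\<lambda>\<xi>. \<epsilon> * f \<xi>) \<and> (\<forall>x\<in>S. f x = 0) \<and>
    (\<forall>Z. f \<in> cfun.span (gaussian ` Z) \<longrightarrow> (\<exists>w\<in>Z. p3 $ j = w $ j))"
proof -
  \<comment> \<open>Scalars accumulated after the first, second and third lower triangular
    step.\<close>
  define a2 a4 a6 where "a2 = ft_factor_vec z1 * ft_factor_vec p1" and "a4 = a2 * ft_factor_vec z3 * ft_factor_vec p3"
    and "a6 = a4 * ft_factor_vec z5 * ft_factor_vec p5"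
  have a6: "a6 = ft_factor_vec z * ft_factor_vec p0" unfolding a6_def a4_def a2_def by (rule closed)
  have im: "Im (z $ i) > 0" "Im (z1 $ i) > 0" "Im (z3 $ i) > 0" "Im (z5 $ i) > 0"
    "Im (p1 $ i) > 0" "Im (p3 $ i) > 0" "Im (p5 $ i) > 0" "Im (p0 $ i) > 0" for i
    using pos by auto
  define k1 k3 k5 k0 where "k1 = cycle_step 1 z1 p1" and "k3 = cycle_step a2 z3 p3"
    and "k5 = cycle_step a4 z5 p5" and "k0 = cycle_step 1 z p0"
  \<comment> \<open>The minus sign traverses the direct step backwards, which closes the
    cycle.\<close>
  define K where "K = (\<lambda>x. k1 x + k3 x + k5 x - k0 x)"
  have k: "k1 \<in> gaussian_span" "k3 \<in> gaussian_span" "k5 \<in> gaussian_span" "k0 \<in> gaussian_span"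
    unfolding k1_def k3_def k5_def k0_def by (intro cycle_step_gaussian_span im)+
  have K: "K \<in> gaussian_span" unfolding K_def by (intro gaussian_span_lam k)
  \<comment> \<open>The terms pair off with opposite coefficients: \<open>z1\<close> and
    \<open>z\<close>, \<open>z3\<close> and \<open>neg_inv p1\<close>, \<open>z5\<close> and
    \<open>neg_inv p3\<close>, \<open>neg_inv p5\<close> and \<open>neg_inv p0\<close>. Each pair of
    Gaussians agrees on \<open>S\<close>.\<close>
  have FK: "fourier_transform K = (\<lambda>\<xi>. (a2 * gaussian (neg_inv p1) \<xi> - gaussian z1 \<xi>)
      + (a4 * gaussian (neg_inv p3) \<xi> - a2 * gaussian z3 \<xi>) + (a6 * gaussian (neg_inv p5) \<xi> - a4 * gaussian z5 \<xi>)
      - (a6 * gaussian (neg_inv p0) \<xi> - gaussian z \<xi>))"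
  proof -
    have "fourier_transform k1 = (\<lambda>\<xi>. a2 * gaussian (neg_inv p1) \<xi> - gaussian z1 \<xi>)"
      unfolding k1_def a2_def using fourier_transform_cycle_step[OF im(2) im(5), of 1] by simp
    moreover have "fourier_transform k3 = (\<lambda>\<xi>. a4 * gaussian (neg_inv p3) \<xi> - a2 * gaussian z3 \<xi>)"
      unfolding k3_def a4_def by (rule fourier_transform_cycle_step[OF im(3) im(6)])
    moreover have "fourier_transform k5 = (\<lambda>\<xi>. a6 * gaussian (neg_inv p5) \<xi> - a4 * gaussian z5 \<xi>)"
      unfolding k5_def a6_def by (rule fourier_transform_cycle_step[OF im(4) im(7)])
    moreover have "fourier_transform k0 = (\<lambda>\<xi>. a6 * gaussian (neg_inv p0) \<xi> - gaussian z \<xi>)"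
      unfolding k0_def a6 using fourier_transform_cycle_step[OF im(1) im(8), of 1] by simp
    ultimately show ?thesis
      unfolding K_def
      by (simp only: fourier_transform_diff[OF gaussian_span_lam(1)[OF gaussian_span_lam(1)[OF k(1,2)] k(3)] k(4)]
          fourier_transform_add[OF gaussian_span_lam(1)[OF k(1,2)] k(3)] fourier_transform_add[OF k(1,2)])
  qed
  define f where "f = (\<lambda>x. \<epsilon> * fourier_transform K x + K x)"
  have f: "f \<in> gaussian_span"
    unfolding f_def by (intro gaussian_span_lam K fourier_transform_in_gaussian_span)
  \<comment> \<open>Since \<epsilon>^2 = 1 and F is an involution, \<epsilon> F K + K goes to
    \<epsilon> K + F K = \<epsilon> f.\<close>
  moreover have "fourier_transform f = (\<lambda>\<xi>. \<epsilon> * f \<xi>)"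
    using eps
    by (auto simp: f_def fourier_transform_linear[OF fourier_transform_in_gaussian_span[OF K] K] fourier_transform_involution[OF K])
  moreover have "f x = 0" if "x \<in> S" for x
  proof -
    have "k1 x = 0" "k3 x = 0" "k5 x = 0" "k0 x = 0"
      using eqs(1-4)[OF that] by (simp_all add: k1_def k3_def k5_def k0_def cycle_step_def)
    moreover have "fourier_transform K x = 0"
      using eqs(5-8)[OF that] by (simp add: FK)
    ultimately show ?thesis by (simp add: f_def K_def)
  qed
  moreover have "\<exists>w\<in>Z. p3 $ j = w $ j" if fZ: "f \<in> cfun.span (gaussian ` Z)" for Z
  proof (rule ccontr)
    assume no: "\<not> (\<exists>w\<in>Z. p3 $ j = w $ j)"
    \<comment> \<open>By \<open>uniq\<close>, the Gaussian of \<open>p3\<close> is the only one in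
      \<open>f\<close> with parameter outside \<open>P\<close>, and its coefficient is nonzero. If
      \<open>f\<close> lay in the span over \<open>P\<close>, so would this Gaussian.\<close>
    define P where "P = {w. p3 $ j \<noteq> w $ j}"
    let ?V = "cfun.span (gaussian ` P)"
    have "Z \<subseteq> P" using no by (auto simp: P_def)
    then have fP: "f \<in> ?V" using fZ cfun.span_mono[of "gaussian ` Z" "gaussian ` P"] by blast
    have base: "gaussian w \<in> ?V"
      if "w \<in> {p1, neg_inv z1, neg_inv z3, p5, neg_inv z5, p0, neg_inv z, z, z1, neg_inv p1, z3, neg_inv p3, z5,
        neg_inv p5, neg_inv p0}" for w
      using uniq that unfolding P_def by (intro cfun.span_base imageI) blast
    note V = base cfun_span_lam[of _ "gaussian ` P"] cfun_span_lam_scale[of _ "gaussian ` P"]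
    have "(\<lambda>x. f x - (\<epsilon> * fourier_transform K x
        + (k1 x + k5 x - k0 x - a2 * ft_factor_vec z3 * gaussian (neg_inv z3) x))) \<in> ?V"
      unfolding FK k1_def k5_def k0_def cycle_step_def by (intro V fP) auto
    also have "(\<lambda>x. f x - (\<epsilon> * fourier_transform K x
        + (k1 x + k5 x - k0 x - a2 * ft_factor_vec z3 * gaussian (neg_inv z3) x)))
        = (\<lambda>x. a2 * ft_factor_vec z3 * gaussian p3 x)"
      by (simp add: fun_eq_iff f_def K_def k3_def cycle_step_def right_diff_distrib)
    finally have inV: "(\<lambda>x. inverse (a2 * ft_factor_vec z3) * (a2 * ft_factor_vec z3 * gaussian p3 x)) \<in> ?V"
      by (rule V)
    have "a2 * ft_factor_vec z3 \<noteq> 0"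
      unfolding a2_def by (simp add: ft_factor_vec_nonzero im)
    moreover have "inverse c * (c * g) = g" if "c \<noteq> 0" for c g :: complex
      using that by simp
    ultimately have "(\<lambda>x. inverse (a2 * ft_factor_vec z3) * (a2 * ft_factor_vec z3 * gaussian p3 x)) = gaussian p3"
      by blast
    with inV have "gaussian p3 \<in> ?V" by simp
    moreover have "p3 \<notin> P" by (simp add: P_def)
    ultimately show False using gaussian_not_in_span by blast
  qed
  ultimately show ?thesis by blast
qed

lemma gaussian_span_finite_support:
  assumes "f \<in> gaussian_span"
  shows "\<exists>Z. finite Z \<and> f \<in> cfun.span (gaussian ` Z)"
  using assms
proof (induction f rule: gaussian_span_induct)
  case (gauss z)
  then show ?case by (intro exI[of _ "{z}"]) (auto intro: cfun.span_base)
next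
  case (lin f g c)
  then obtain Z Z' where Z: "finite Z" "f \<in> cfun.span (gaussian ` Z)"
    "finite Z'" "g \<in> cfun.span (gaussian ` Z')" by blast
  then have "f \<in> cfun.span (gaussian ` (Z \<union> Z'))" "g \<in> cfun.span (gaussian ` (Z \<union> Z'))"
    using cfun.span_mono[OF image_mono, of Z "Z \<union> Z'" gaussian]
      cfun.span_mono[OF image_mono, of Z' "Z \<union> Z'" gaussian] by auto
  then show ?case using Z by (intro exI[of _ "Z \<union> Z'"] conjI cfun_span_lam cfun_span_lam_scale) auto
next
  case zero
  show ?case using cfun.span_zero by (intro exI[of _ "{}"]) (simp add: zero_fun_def)
qed

section \<open>Application to the square root of the codifferent\<close>

context real_embeddings
begin

text \<open>The assumption matches \<open>b\<close> with the basis picked in the definition of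
  \<open>field_trace\<close>, so the trace becomes the diagonal sum in
  \<open>sum_coord_diag\<close>.\<close>

lemma field_trace_eq:
  assumes "range b = (SOME B. rat_basis B)"
  shows "of_rat (field_trace x) = (\<Sum>i\<in>UNIV. \<sigma> i x)"
proof -
  have "field_trace x = (\<Sum>v\<in>range b. rat_vs.representation (range b) (x * v) v)"
    by (simp add: field_trace_def assms Let_def)
  also have "\<dots> = (\<Sum>i\<in>UNIV. coord (x * b i) i)"
    by (subst sum.reindex) (auto simp: inj_b coord_def)
  finally show ?thesis using sum_coord_diag[of x] by simp
qed

lemma gaussian_shift:
  assumes "range b = (SOME B. rat_basis B)"
    and "x \<in> sqrt_set \<sigma> codifferent" "a \<in> order_ring"
    and "\<And>i. w $ i = z $ i + complex_of_real (2 * \<sigma> i a)"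
  shows "gaussian w x = gaussian z x"
proof -
  obtain \<alpha> where \<alpha>: "\<alpha> \<in> codifferent" "\<And>i. (x $ i)\<^sup>2 = \<sigma> i \<alpha>"
    using assms(2) by (auto simp: sqrt_set_def)
  have "field_trace (a * \<alpha>) \<in> \<int>"
    using \<alpha>(1) algebraic_int_order_ring[OF assms(3)]
    by (auto simp: codifferent_def ring_of_integers_def)
  then obtain k where "field_trace (a * \<alpha>) = of_int k" by (auto elim: Ints_cases)
  then have k: "(\<Sum>i\<in>UNIV. \<sigma> i a * \<sigma> i \<alpha>) = of_int k"
    using field_trace_eq[OF assms(1), of "a * \<alpha>"] by (simp add: emb_mult)
  have "gaussian_1d (w $ i) (x $ i) = gaussian_1d (z $ i) (x $ i) * exp (2 * of_real pi * \<i> * of_real (\<sigma> i a * \<sigma> i \<alpha>))" for i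
    unfolding gaussian_1d_def assms(4) exp_add[symmetric] of_real_power[symmetric] \<alpha>(2)
    by (simp add: algebra_simps)
  then have "gaussian w x = gaussian z x * exp (\<Sum>i\<in>UNIV. 2 * of_real pi * \<i> * of_real (\<sigma> i a * \<sigma> i \<alpha>))"
    by (simp add: gaussian_eq_prod prod.distrib exp_sum)
  also have "(\<Sum>i\<in>UNIV. 2 * of_real pi * \<i> * of_real (\<sigma> i a * \<sigma> i \<alpha>)) = 2 * complex_of_real pi * \<i> * of_int k"
    by (simp only: sum_distrib_left[symmetric] of_real_sum[symmetric] k of_real_of_int_eq)
  also have "exp (2 * complex_of_real pi * \<i> * of_int k) = 1"
    using exp_2pi_1_int[of k] by (simp add: mult_ac)
  finally show ?thesis by simp
qed

text \<open>The one-variable cycle is run in every coordinate with the conjugates of u and y, always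
  starting from \<i> and with the same X = 2m. A large \<open>m\<close> moves the coordinate
  \<open>j\<close> of \<open>p3\<close> away from \<open>Z\<close> and from the other parameters;
  differing in one coordinate is enough.\<close>

lemma eigenfunction_outside_finite_span:
  fixes u s :: 'k and j :: 'n
  defines "y \<equiv> 2 * s"
  assumes range: "range b = (SOME B. rat_basis B)"
    and u: "u = 1 - 4 * s" "s \<in> order_ring" "inverse u \<in> order_ring" "u \<noteq> 0" "u\<^sup>2 \<noteq> 1"
    and eps: "\<epsilon> \<in> {1, -1}" and "finite Z"
  shows "\<exists>f\<in>gaussian_span. fourier_transform f = (\<lambda>\<xi>. \<epsilon> * f \<xi>) \<and>
    (\<forall>x\<in>sqrt_set \<sigma> codifferent. f x = 0) \<and> f \<notin> cfun.span (gaussian ` Z)"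
proof -
  have cyc: "mobius_cycle (\<sigma> i u) (\<sigma> i y) \<i>" for i
  proof
    show "\<sigma> i u = 1 - 2 * \<sigma> i y"
      unfolding u(1) y_def by (simp add: emb_diff emb_mult emb_numeral)
  qed (use u in auto)
  define q1 where "q1 = mobius_cycle.q1 \<i>"
  define Z3 where "Z3 i = mobius_cycle.z3 (\<sigma> i u) (\<sigma> i y) \<i>" for i
  define Q3 where "Q3 i = mobius_cycle.q3 (\<sigma> i u) (\<sigma> i y) \<i>" for i
  define Z5 where "Z5 i X = mobius_cycle.z5 (\<sigma> i u) (\<sigma> i y) \<i> X" for i X
  define Q5 where "Q5 i X = mobius_cycle.q5 (\<sigma> i u) (\<sigma> i y) \<i> X" for i X
  note defs = q1_def Z3_def Q3_def Z5_def Q5_def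
  \<comment> \<open>Embeddings are injective, so u^2 \<noteq> 1 passes to the conjugate that
    \<open>eventually_unique\<close> is applied to.\<close>
  have "\<sigma> j u \<noteq> 1 \<and> \<sigma> j u \<noteq> - 1"
    using u(5) emb_eq_iff[of j u 1] emb_eq_iff[of j u "- 1"] by (auto simp: emb_minus)
  then have "(\<sigma> j u)\<^sup>2 \<noteq> 1" by (simp add: power2_eq_1_iff)
  note ev = eventually_conj[OF mobius_cycle.eventually_unique[OF cyc this]
      mobius_cycle.eventually_avoids[OF cyc finite_imageI[OF \<open>finite Z\<close>, of "\<lambda>w. w $ j"], of j]]
  obtain m :: nat where m: "Q3 j + of_real (2 * real m) \<notin> {q1 - \<sigma> j y, q1, Q3 j, Q5 j (2 * real m) + \<sigma> j y, Q5 j (2 * real m),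
        - 1 / \<i> + of_real (2 * real m / (\<sigma> j u)\<^sup>2), - 1 / \<i>, \<i>, \<i> - 2, - 1 / (q1 - \<sigma> j y), Z3 j,
        - 1 / (Q3 j + of_real (2 * real m)), Z5 j (2 * real m), - 1 / (Q5 j (2 * real m) + \<sigma> j y),
        - 1 / (- 1 / \<i> + of_real (2 * real m / (\<sigma> j u)\<^sup>2))}"
    "Q3 j + of_real (2 * real m) \<notin> (\<lambda>w. w $ j) ` Z"
    using eventually_happens'[OF sequentially_bot ev] unfolding defs by blast
  define X where "X = 2 * real m"
  define z z1 z3 z5 p1 p3 p5 p0 :: "complex ^ 'n"
    where "z = (\<chi> i. \<i>)" and "z1 = (\<chi> i. \<i> - 2)" and "z3 = (\<chi> i. Z3 i)" and "z5 = (\<chi> i. Z5 i X)"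
      and "p1 = (\<chi> i. q1 - \<sigma> i y)" and "p3 = (\<chi> i. Q3 i + of_real X)"
      and "p5 = (\<chi> i. Q5 i X + \<sigma> i y)" and "p0 = (\<chi> i. - 1 / \<i> + of_real (X / (\<sigma> i u)\<^sup>2))"
  note vdefs = z_def z1_def z3_def z5_def p1_def p3_def p5_def p0_def
  note q_eqs = mobius_cycle.q1_def[OF cyc, folded defs] mobius_cycle.q3_def[OF cyc, folded defs]
    mobius_cycle.q5_def[OF cyc, folded defs]
  have neg_inv: "neg_inv z1 $ i = q1" "neg_inv z3 $ i = Q3 i" "neg_inv z5 $ i = Q5 i X" "neg_inv z $ i = - 1 / \<i>"
    "neg_inv p1 $ i = - 1 / (q1 - \<sigma> i y)" "neg_inv p3 $ i = - 1 / (Q3 i + of_real X)"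
    "neg_inv p5 $ i = - 1 / (Q5 i X + \<sigma> i y)"
    "neg_inv p0 $ i = - 1 / (- 1 / \<i> + of_real (X / (\<sigma> i u)\<^sup>2))" for i
    by (simp_all only: neg_inv_def vdefs vec_lambda_beta q_eqs)
  \<comment> \<open>These are the elements whose doubled conjugates are, up to sign, the
    translations of the cycle: y, 2, 2/u, X and X/u^2.\<close>
  have R: "s \<in> order_ring" "- 1 \<in> order_ring" "inverse u \<in> order_ring" "of_nat m \<in> order_ring"
    "of_nat m * (inverse u * inverse u) \<in> order_ring"
    using order_ring_of_int[of "-1"] order_ring_of_int[of "int m"] u
    by (auto intro!: order_ring_mult)
  have \<sigma>R: "2 * \<sigma> i s = \<sigma> i y" "2 * \<sigma> i (- 1) = - 2" "2 * \<sigma> i (inverse u) = 2 / \<sigma> i u"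
    "2 * \<sigma> i (of_nat m) = X" "2 * \<sigma> i (of_nat m * (inverse u * inverse u)) = X / (\<sigma> i u)\<^sup>2" for i
    by (simp_all add: y_def emb_mult emb_numeral emb_minus emb_inverse emb_of_nat X_def power2_eq_square divide_inverse)
  note shift = gaussian_shift[OF range]
  have "\<exists>f\<in>gaussian_span. fourier_transform f = (\<lambda>\<xi>. \<epsilon> * f \<xi>) \<and>
    (\<forall>x\<in>sqrt_set \<sigma> codifferent. f x = 0) \<and>
    (\<forall>Z. f \<in> cfun.span (gaussian ` Z) \<longrightarrow> (\<exists>w\<in>Z. p3 $ j = w $ j))"
  proof (rule cycle_eigenfunction[OF _ _ _ _ _ _ _ _ _ _ eps])
    show "\<forall>w\<in>{z, z1, z3, z5, p1, p3, p5, p0}. \<forall>i. Im (w $ i) > 0"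
      using mobius_cycle.Im_pos[OF cyc, folded defs] mobius_cycle.Im_shift[OF cyc, folded defs]
      by (simp only: vdefs vec_lambda_beta ball_simps) simp
    have "ft_factor (\<i> - 2) * ft_factor (q1 - \<sigma> i y) * ft_factor (Z3 i) * ft_factor (Q3 i + of_real X) * ft_factor (Z5 i X)
        * ft_factor (Q5 i X + \<sigma> i y) = ft_factor \<i> * ft_factor (- 1 / \<i> + of_real (X / (\<sigma> i u)\<^sup>2))" for i
      using mobius_cycle.factors_agree[OF cyc, of i X]
      unfolding mobius_cycle.cycle_factor_def[OF cyc] mobius_cycle.direct_factor_def[OF cyc] defs .
    then show "ft_factor_vec z1 * ft_factor_vec p1 * ft_factor_vec z3 * ft_factor_vec p3 * ft_factor_vec z5 * ft_factor_vec p5 = ft_factor_vec z * ft_factor_vec p0"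
      by (simp only: ft_factor_vec_def vdefs vec_lambda_beta prod.distrib[symmetric])
    show "p3 $ j \<notin> (\<lambda>w. w $ j) ` {p1, neg_inv z1, neg_inv z3, p5, neg_inv z5, p0, neg_inv z, z, z1, neg_inv p1, z3, neg_inv p3, z5,
        neg_inv p5, neg_inv p0}"
      unfolding image_insert image_empty neg_inv
      using m(1)[folded X_def] by (simp only: vdefs vec_lambda_beta not_False_eq_True)
    fix x assume x: "x \<in> sqrt_set \<sigma> codifferent"
    show "gaussian p1 x = gaussian (neg_inv z1) x"
      by (rule shift[OF x R(1), symmetric]) (simp only: \<sigma>R neg_inv p1_def vec_lambda_beta, simp)
    show "gaussian p3 x = gaussian (neg_inv z3) x"
      by (rule shift[OF x R(4)]) (simp only: \<sigma>R neg_inv p3_def vec_lambda_beta)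
    show "gaussian p5 x = gaussian (neg_inv z5) x"
      by (rule shift[OF x R(1)]) (simp only: \<sigma>R neg_inv p5_def vec_lambda_beta)
    show "gaussian p0 x = gaussian (neg_inv z) x"
      by (rule shift[OF x R(5)]) (simp only: \<sigma>R neg_inv p0_def vec_lambda_beta)
    show "gaussian z1 x = gaussian z x"
      by (rule shift[OF x R(2)]) (simp only: \<sigma>R z_def z1_def vec_lambda_beta, simp)
    show "gaussian z3 x = gaussian (neg_inv p1) x"
      by (rule shift[OF x R(3)])
        (simp only: \<sigma>R z3_def neg_inv vec_lambda_beta mobius_cycle.z3_def[OF cyc, folded defs])
    show "gaussian z5 x = gaussian (neg_inv p3) x"
      by (rule shift[OF x R(3), symmetric])
        (simp only: \<sigma>R z5_def neg_inv vec_lambda_beta mobius_cycle.z5_def[OF cyc, folded defs], simp)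
    show "gaussian (neg_inv p0) x = gaussian (neg_inv p5) x"
      by (rule shift[OF x R(2), symmetric])
        (simp only: \<sigma>R neg_inv mobius_cycle.cycle_closes[OF cyc, folded defs, symmetric], simp)
  qed
  then obtain f where f: "f \<in> gaussian_span" "fourier_transform f = (\<lambda>\<xi>. \<epsilon> * f \<xi>)"
    "\<forall>x\<in>sqrt_set \<sigma> codifferent. f x = 0"
    "\<forall>Z. f \<in> cfun.span (gaussian ` Z) \<longrightarrow> (\<exists>w\<in>Z. p3 $ j = w $ j)" by blast
  moreover have "p3 $ j \<noteq> w $ j" if "w \<in> Z" for w
    using m(2) that by (auto simp: p3_def X_def)
  ultimately show ?thesis by blast
qed

end

lemma finite_set_finite_support:
  assumes "finite B" "B \<subseteq> gaussian_span"
  shows "\<exists>Z. finite Z \<and> B \<subseteq> cfun.span (gaussian ` Z)"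
  using assms
proof (induction B rule: finite_induct)
  case (insert f B)
  then obtain Z Z' where Z: "finite Z" "B \<subseteq> cfun.span (gaussian ` Z)"
    "finite Z'" "f \<in> cfun.span (gaussian ` Z')"
    using gaussian_span_finite_support[of f] by blast
  then show ?case
    using cfun.span_mono[OF image_mono, of Z "Z \<union> Z'" gaussian]
      cfun.span_mono[OF image_mono, of Z' "Z \<union> Z'" gaussian]
    by (intro exI[of _ "Z \<union> Z'"]) auto
qed auto

theorem theorem1:
  fixes \<sigma> :: "'n::finite \<Rightarrow> 'k::field_char_0 \<Rightarrow> real"
    and \<epsilon> :: complex
  assumes "number_field TYPE('k)"
    and "totally_real TYPE('k)"
    and "field_degree TYPE('k) = CARD('n)"
    and "CARD('n) \<ge> 2"
    and "bij_betw \<sigma> UNIV {\<tau> :: 'k \<Rightarrow> real. field_embedding \<tau>}"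
    and "\<epsilon> \<in> {1, -1}"
  shows "infinite_dimensional_subspace
    {f \<in> gaussian_span :: (real ^ 'n \<Rightarrow> complex) set.
       fourier_transform f = (\<lambda>\<xi>. \<epsilon> * f \<xi>) \<and>
       (\<forall>x \<in> sqrt_set \<sigma> (codifferent :: 'k set). f x = 0)}"
    (is "infinite_dimensional_subspace ?W")
proof -
  \<comment> \<open>\<open>gaussian_shift\<close> is stated for exactly the basis that
    \<open>field_trace\<close> chooses.\<close>
  define B where "B = (SOME B :: 'k set. rat_basis B)"
  have B: "rat_basis B" using assms(1) unfolding number_field_def B_def by (rule someI_ex)
  have "card B = CARD('n)"
    using B assms(3) rat_vs.dim_span[of B] rat_vs.dim_eq_card_independent[of B]
    by (simp add: rat_basis_def field_degree_def)
  then obtain b :: "'n \<Rightarrow> 'k" where b: "bij_betw b UNIV B"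
    using B finite_same_card_bij[of "UNIV :: 'n set" B] by (auto simp: rat_basis_def)
  then have range: "range b = B" by (simp add: bij_betw_def)
  interpret real_embeddings \<sigma> b
  proof
    show "field_embedding (\<sigma> i)" for i using assms(5) by (auto simp: bij_betw_def)
    show "inj \<sigma>" using assms(5) by (simp add: bij_betw_def)
    show "inj b" using b by (simp add: bij_betw_def)
    show "rat_basis (range b)" by (simp add: range B)
  qed
  obtain u s where u: "u = 1 - 4 * s" "s \<in> order_ring" "u \<in> order_ring" "inverse u \<in> order_ring"
    "u \<noteq> 0" "u\<^sup>2 \<noteq> 1"
    using unit_congruent_1_mod_4[OF assms(4)] by blast
  have "cfun.subspace ?W"
    unfolding cfun.subspace_def
  proof (intro conjI ballI allI)
    show "0 \<in> ?W" by (simp add: zero_fun_def zero_in_gaussian_span fourier_transform_zero)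
    show "f + g \<in> ?W" if "f \<in> ?W" "g \<in> ?W" for f g
      using that by (auto simp: plus_fun_def gaussian_span_lam fourier_transform_add distrib_left)
    show "(\<lambda>x. c * f x) \<in> ?W" if "f \<in> ?W" for c f
      using that by (auto simp: gaussian_span_lam fourier_transform_scale mult.left_commute)
  qed
  \<comment> \<open>A finite spanning set involves only finitely many Gaussians, so the whole space
    would lie in their span; the preceding construction gives an eigenfunction outside it.\<close>
  moreover have False if fin: "finite F" "F \<subseteq> ?W" and span: "cfun.span F = ?W" for F
  proof -
    have "F \<subseteq> gaussian_span" using fin(2) by blast
    then obtain Z where Z: "finite Z" "F \<subseteq> cfun.span (gaussian ` Z)"
      using finite_set_finite_support[OF fin(1)] by blast
    obtain f where "f \<in> ?W" "f \<notin> cfun.span (gaussian ` Z)"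
      using eigenfunction_outside_finite_span[OF range[unfolded B_def] u(1,2,4,5,6) assms(6) Z(1)] by blast
    moreover have "cfun.span F \<subseteq> cfun.span (gaussian ` Z)"
      using Z(2) cfun.span_minimal cfun.subspace_span by blast
    ultimately show False using span by blast
  qed
  ultimately show ?thesis unfolding infinite_dimensional_subspace_def by blast
qed

end
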